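(* Let $\lambda\in\mathbf R$ and write $Q=Q(\lambda,1)$, $f=f(\lambda)$ (notation of the context). (i) If $f>0$ and $Q^2>f$, there exists a family of real touching conics of generic type on $H_\lambda$, parametrized by a circle, with defining equations $$2(Q^2-f)y_1^2+\sqrt f\,e^{i\theta}y_2^2+2Qy_2y_3+\sqrt f\,e^{-i\theta}y_3^2=0,\qquad\theta\in\mathbf R,$$ and every real touching conic of generic type in $H_\lambda$ is a member of this family. (ii) If $f<0$ or $Q^2=f$, there is no real touching conic of generic type on $H_\lambda$. (iii) If $Q^2>f>0$, the conic displayed in (i) has no real point for any $\theta\in\mathbf R$.
   Context: Fix real numbers $a,b>0$ and a real quadratic form $Q(y_0,y_1)$; put $f(\lambda)=\lambda(\lambda+1)(a\lambda-b)$. Assume: there is $\lambda_0\in\mathbf R$ such that $Q(\lambda,1)^2-f(\lambda)\ge0$ for all $\lambda\in\mathbf R$ with equality iff $\lambda=\lambda_0$, and $\lambda_0$ is a root of multiplicity two; and $Q(\lambda,1)>\sqrt{f(\lambda)}$ whenever $\lambda\in\mathbf R$, $f(\lambda)\ge0$, $\lambda\ne\lambda_0$. $B\subset\mathbf{CP}^3$ is the quartic surface $(y_2y_3+Q(y_0,y_1))^2-y_0y_1(y_0+y_1)(ay_0-by_1)=0$; the real structure on $\mathbf{CP}^3$ is $\sigma(y_0:y_1:y_2:y_3)=(\overline y_0:\overline y_1:\overline y_3:\overline y_2)$. For $\lambda\in\mathbf R$, $H_\lambda=\{y_0=\lambda y_1\}$ is a real plane with homogeneous coordinates $(y_1:y_2:y_3)$,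 and $B_\lambda=B\cap H_\lambda$ is the quartic curve $(y_2y_3+Qy_1^2)^2-fy_1^4=0$. Put $P_\infty=(0:0:0:1)$, $\overline P_\infty=(0:0:1:0)$. "Real" means invariant under $\sigma$. A real touching conic in $H_\lambda$ is a real irreducible conic $C\subset H_\lambda$ such that either $C\subset B$ or the local intersection number of $C$ with $B_\lambda$ is at least two at every intersection point. It is of generic type if $(C,B_\lambda)_{P_\infty}=(C,B_\lambda)_{\overline P_\infty}=0$ (local intersection numbers), i.e. $C$ does not pass through $P_\infty,\overline P_\infty$. *)

theory Defs
  imports
    "HOL-Analysis.Analysis"
    "HOL-Computational_Algebra.Polynomial"
    "HOL-Computational_Algebra.Fraction_Field"
    "HOL-Library.Extended_Nat"
begin

subsection \<open>Complex projective space\<close>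

definition proj_rel :: "complex ^ 'n \<Rightarrow> complex ^ 'n \<Rightarrow> bool" where
  "proj_rel x y \<longleftrightarrow> x \<noteq> 0 \<and> y \<noteq> 0 \<and> (\<exists>c. y = c *s x)"

lemma part_equivp_proj_rel: "part_equivp (proj_rel :: complex ^ 'n \<Rightarrow> _)"
proof (rule part_equivpI)
  have "proj_rel (axis undefined 1) (axis undefined (1::complex) :: complex ^ 'n)"
    by (auto simp: proj_rel_def axis_eq_0_iff intro: exI[of _ 1])
  then show "\<exists>x :: complex ^ 'n. proj_rel x x" ..
  show "symp (proj_rel :: complex ^ 'n \<Rightarrow> _)"
  proof (rule sympI)
    fix x y :: "complex ^ 'n" assume "proj_rel x y"
    then obtain c where c: "x \<noteq> 0" "y \<noteq> 0" "y = c *s x" by (auto simp: proj_rel_def)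
    then have "c \<noteq> 0" by auto
    then have "x = (1 / c) *s y" by (simp add: c(3) vector_smult_assoc)
    then show "proj_rel y x" using c(1,2) unfolding proj_rel_def by blast
  qed
  show "transp (proj_rel :: complex ^ 'n \<Rightarrow> _)"
    by (rule transpI) (auto simp: proj_rel_def vector_smult_assoc)
qed

text \<open>The type \<open>'n cproj\<close> is the projective space of dimension \<open>CARD('n) - 1\<close>: plane points are
  of type \<open>3 cproj\<close>, space points of type \<open>4 cproj\<close>.\<close>

quotient_type 'n cproj = "complex ^ 'n" / partial: "proj_rel :: complex ^ 'n \<Rightarrow> _"
  by (rule part_equivp_proj_rel)

abbreviation pt :: "complex ^ 'n \<Rightarrow> 'n cproj" where
  "pt \<equiv> abs_cproj"

text \<open>Coordinates on the space are indexed by \<open>0, 1, 2, 3 :: 4\<close>. The plane has coordinates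
  \<open>(y\<^sub>1 : y\<^sub>2 : y\<^sub>3)\<close>, indexed by \<open>1, 2, 3 :: 3\<close>.\<close>

definition hvec :: "complex \<Rightarrow> complex \<Rightarrow> complex \<Rightarrow> complex \<Rightarrow> complex ^ 4" where
  "hvec y0 y1 y2 y3 =
     (\<chi> i. if i = 0 then y0 else if i = 1 then y1 else if i = 2 then y2 else y3)"

lemma hvec_nth [simp]:
  "hvec y0 y1 y2 y3 $ 0 = y0" "hvec y0 y1 y2 y3 $ 1 = y1"
  "hvec y0 y1 y2 y3 $ 2 = y2" "hvec y0 y1 y2 y3 $ 3 = y3"
  by (simp_all add: hvec_def)

lemma four_cases: "(\<forall>i::4. P i) \<longleftrightarrow> P 0 \<and> P 1 \<and> P 2 \<and> P 3"
proof -
  have "(4::4) = 0" by simp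
  then have "P 4 = P 0" by (rule arg_cong)
  then show ?thesis using forall_4[of P] by blast
qed

lemma vec4_eq_iff:
  "(x :: complex ^ 4) = y \<longleftrightarrow> x $ 0 = y $ 0 \<and> x $ 1 = y $ 1 \<and> x $ 2 = y $ 2 \<and> x $ 3 = y $ 3"
  by (simp add: vec_eq_iff four_cases)

lemma vec3_eq_iff:
  "(x :: complex ^ 3) = y \<longleftrightarrow> x $ 1 = y $ 1 \<and> x $ 2 = y $ 2 \<and> x $ 3 = y $ 3"
  by (simp add: vec_eq_iff forall_3)

lift_definition real_str :: "4 cproj \<Rightarrow> 4 cproj" is
  "\<lambda>y. hvec (cnj (y $ 0)) (cnj (y $ 1)) (cnj (y $ 3)) (cnj (y $ 2))"
proof -
  fix x y :: "complex ^ 4" assume "proj_rel x y"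
  then obtain c where c: "x \<noteq> 0" "y \<noteq> 0" "y = c *s x" by (auto simp: proj_rel_def)
  then have "hvec (cnj (y $ 0)) (cnj (y $ 1)) (cnj (y $ 3)) (cnj (y $ 2)) =
    cnj c *s hvec (cnj (x $ 0)) (cnj (x $ 1)) (cnj (x $ 3)) (cnj (x $ 2))"
    by (simp add: vec4_eq_iff)
  then show "proj_rel (hvec (cnj (x $ 0)) (cnj (x $ 1)) (cnj (x $ 3)) (cnj (x $ 2)))
      (hvec (cnj (y $ 0)) (cnj (y $ 1)) (cnj (y $ 3)) (cnj (y $ 2)))"
    using c(1,2) unfolding proj_rel_def by (auto simp: vec4_eq_iff)
qed

definition real_set :: "4 cproj set \<Rightarrow> bool" where
  "real_set C \<longleftrightarrow> real_str ` C = C"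

definition P_inf :: "4 cproj" where
  "P_inf = pt (hvec 0 0 0 1)"

definition P_inf_bar :: "4 cproj" where
  "P_inf_bar = pt (hvec 0 0 1 0)"


subsection \<open>The quartic surface and its real plane sections\<close>

text \<open>These expressions are polymorphic: they are used over the reals, the complex numbers and
  polynomial rings.\<close>

definition qform :: "'a::comm_ring_1 \<Rightarrow> 'a \<Rightarrow> 'a \<Rightarrow> 'a \<Rightarrow> 'a \<Rightarrow> 'a" where
  "qform q0 q1 q2 y0 y1 = q0 * y0\<^sup>2 + q1 * y0 * y1 + q2 * y1\<^sup>2"

definition cubic :: "'a::comm_ring_1 \<Rightarrow> 'a \<Rightarrow> 'a \<Rightarrow> 'a" where
  "cubic a b l = l * (l + 1) * (a * l - b)"

definition quartic ::
  "'a::comm_ring_1 \<Rightarrow> 'a \<Rightarrow> 'a \<Rightarrow> 'a \<Rightarrow> 'a \<Rightarrow> 'a \<Rightarrow> 'a \<Rightarrow> 'a \<Rightarrow> 'a \<Rightarrow> 'a" where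
  "quartic a b q0 q1 q2 y0 y1 y2 y3 =
     (y2 * y3 + qform q0 q1 q2 y0 y1)\<^sup>2 - y0 * y1 * (y0 + y1) * (a * y0 - b * y1)"

definition surfaceB :: "real \<Rightarrow> real \<Rightarrow> real \<Rightarrow> real \<Rightarrow> real \<Rightarrow> 4 cproj set" where
  "surfaceB a b q0 q1 q2 =
     {pt y | y. y \<noteq> 0 \<and>
        quartic (of_real a) (of_real b) (of_real q0) (of_real q1) (of_real q2)
          (y $ 0) (y $ 1) (y $ 2) (y $ 3) = 0}"

definition planeH :: "real \<Rightarrow> 4 cproj set" where
  "planeH l = {pt y | y. y \<noteq> 0 \<and> y $ 0 = of_real l * y $ 1}"

lift_definition plane_incl :: "real \<Rightarrow> 3 cproj \<Rightarrow> 4 cproj" is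
  "\<lambda>l y. hvec (of_real l * y $ 1) (y $ 1) (y $ 2) (y $ 3)"
proof -
  fix l :: real and x y :: "complex ^ 3" assume "proj_rel x y"
  then obtain c where c: "x \<noteq> 0" "y \<noteq> 0" "y = c *s x" by (auto simp: proj_rel_def)
  then have "hvec (of_real l * y $ 1) (y $ 1) (y $ 2) (y $ 3) =
    c *s hvec (of_real l * x $ 1) (x $ 1) (x $ 2) (x $ 3)"
    by (simp add: vec4_eq_iff)
  then show "proj_rel (hvec (of_real l * x $ 1) (x $ 1) (x $ 2) (x $ 3))
      (hvec (of_real l * y $ 1) (y $ 1) (y $ 2) (y $ 3))"
    using c(1,2) unfolding proj_rel_def by (auto simp: vec4_eq_iff vec3_eq_iff)
qed


subsection \<open>Plane curves and local intersection numbers\<close>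

text \<open>The homogeneous coordinate ring of the plane is the iterated polynomial ring with
  \<open>y\<^sub>1\<close> as outermost and \<open>y\<^sub>3\<close> as innermost variable.\<close>

type_synonym cpoly3 = "complex poly poly poly"

definition K :: "complex \<Rightarrow> cpoly3" where "K c = [:[:[:c:]:]:]"
definition Y1 :: cpoly3 where "Y1 = [:0, 1:]"
definition Y2 :: cpoly3 where "Y2 = [:[:0, 1:]:]"
definition Y3 :: cpoly3 where "Y3 = [:[:[:0, 1:]:]:]"

definition eval3 :: "cpoly3 \<Rightarrow> complex ^ 3 \<Rightarrow> complex" where
  "eval3 F y = poly (poly (poly F [:[:y $ 1:]:]) [:y $ 2:]) (y $ 3)"

definition homogeneous :: "nat \<Rightarrow> cpoly3 \<Rightarrow> bool" where
  "homogeneous d F \<longleftrightarrow> (\<forall>i j k. coeff (coeff (coeff F i) j) k \<noteq> 0 \<longrightarrow> i + j + k = d)"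

definition zeros :: "cpoly3 \<Rightarrow> 3 cproj set" where
  "zeros F = {pt y | y. y \<noteq> 0 \<and> eval3 F y = 0}"

text \<open>The local ring of the plane at \<open>p\<close>, as a subring of the field of fractions of the
  homogeneous coordinate ring, and the ideal of it defined by the curves \<open>F = 0\<close> and \<open>G = 0\<close>
  (the degree-zero part of the localisation of the homogeneous ideal generated by \<open>F\<close> and \<open>G\<close>).\<close>

definition local_ring :: "3 cproj \<Rightarrow> cpoly3 fract set" where
  "local_ring p =
     {Fract A D | A D d. homogeneous d A \<and> homogeneous d D \<and> p \<notin> zeros D}"

definition local_ideal :: "cpoly3 \<Rightarrow> cpoly3 \<Rightarrow> 3 cproj \<Rightarrow> cpoly3 fract set" where
  "local_ideal F G p =
     {Fract (M * F + N * G) D | M N D d.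
        homogeneous d (M * F + N * G) \<and> homogeneous d D \<and> p \<notin> zeros D}"

text \<open>The local intersection number is the complex dimension of the quotient of the local ring by
  this ideal, i.e. the supremum of the sizes of finite sets that are linearly independent modulo
  the ideal; it is infinite if the curves have a common component through \<open>p\<close>.\<close>

definition local_int :: "cpoly3 \<Rightarrow> cpoly3 \<Rightarrow> 3 cproj \<Rightarrow> enat" where
  "local_int F G p =
     Sup {enat (card S) | S. finite S \<and> S \<subseteq> local_ring p \<and>
       (\<forall>c. (\<Sum>s\<in>S. Fract (K (c s)) 1 * s) \<in> local_ideal F G p \<longrightarrow> (\<forall>s\<in>S. c s = 0))}"

text \<open>The equation of the section of the surface by \<open>planeH l\<close>, obtained by substituting
  \<open>y\<^sub>0 = l y\<^sub>1\<close>.\<close>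

definition sectionB :: "real \<Rightarrow> real \<Rightarrow> real \<Rightarrow> real \<Rightarrow> real \<Rightarrow> real \<Rightarrow> cpoly3" where
  "sectionB a b q0 q1 q2 l =
     quartic (K (of_real a)) (K (of_real b)) (K (of_real q0)) (K (of_real q1)) (K (of_real q2))
       (K (of_real l) * Y1) Y1 Y2 Y3"


subsection \<open>Real touching conics\<close>

definition conic_equation :: "real \<Rightarrow> 4 cproj set \<Rightarrow> cpoly3 \<Rightarrow> bool" where
  "conic_equation l C F \<longleftrightarrow>
     homogeneous 2 F \<and> irreducible F \<and> C = plane_incl l ` zeros F"

text \<open>An irreducible conic determines its equation up to a nonzero scalar, and \<open>local_int\<close> does not
  depend on this scalar; hence \<open>\<exists>F\<close> below amounts to ``the'' equation of \<open>C\<close>.\<close>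

definition real_touching_conic ::
  "real \<Rightarrow> real \<Rightarrow> real \<Rightarrow> real \<Rightarrow> real \<Rightarrow> real \<Rightarrow> 4 cproj set \<Rightarrow> bool" where
  "real_touching_conic a b q0 q1 q2 l C \<longleftrightarrow>
     (\<exists>F. conic_equation l C F \<and> real_set C \<and>
       (C \<subseteq> surfaceB a b q0 q1 q2 \<or>
        (\<forall>p. plane_incl l p \<in> C \<inter> surfaceB a b q0 q1 q2 \<longrightarrow>
             local_int F (sectionB a b q0 q1 q2 l) p \<ge> 2)))"

definition generic_type ::
  "real \<Rightarrow> real \<Rightarrow> real \<Rightarrow> real \<Rightarrow> real \<Rightarrow> real \<Rightarrow> 4 cproj set \<Rightarrow> bool" where
  "generic_type a b q0 q1 q2 l C \<longleftrightarrow>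
     (\<exists>F. conic_equation l C F \<and>
       (\<forall>p. plane_incl l p \<in> {P_inf, P_inf_bar} \<longrightarrow>
            local_int F (sectionB a b q0 q1 q2 l) p = 0))"

text \<open>The form \<open>2 (Q\<^sup>2 - f) y\<^sub>1\<^sup>2 + sqrt f e\<^sup>i\<^sup>\<theta> y\<^sub>2\<^sup>2 + 2 Q y\<^sub>2 y\<^sub>3 + sqrt f e\<^sup>-\<^sup>i\<^sup>\<theta> y\<^sub>3\<^sup>2\<close>, for real
  values \<open>Q\<close> and \<open>f\<close>.\<close>

definition family_form :: "real \<Rightarrow> real \<Rightarrow> real \<Rightarrow> cpoly3" where
  "family_form Q f \<theta> =
     K (of_real (2 * (Q\<^sup>2 - f))) * Y1\<^sup>2
     + K (of_real (sqrt f) * exp (\<i> * of_real \<theta>)) * Y2\<^sup>2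
     + K (of_real (2 * Q)) * Y2 * Y3
     + K (of_real (sqrt f) * exp (- (\<i> * of_real \<theta>))) * Y3\<^sup>2"


subsection \<open>Consistency of the encodings\<close>

lemma sectionB_eq:
  "sectionB a b q0 q1 q2 l =
     (Y2 * Y3 + K (of_real (qform q0 q1 q2 l 1)) * Y1\<^sup>2)\<^sup>2 - K (of_real (cubic a b l)) * Y1 ^ 4"
proof -
  have K: "K (x + y) = K x + K y" "K (x - y) = K x - K y" "K (x * y) = K x * K y" "K 1 = 1" for x y
    by (simp_all add: K_def one_pCons)
  show ?thesis
    unfolding sectionB_def quartic_def qform_def cubic_def
    by (simp add: K power2_eq_square) algebra
qed

lemma eval3_sectionB:
  "eval3 (sectionB a b q0 q1 q2 l) y =
     quartic (of_real a) (of_real b) (of_real q0) (of_real q1) (of_real q2)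
       (of_real l * y $ 1) (y $ 1) (y $ 2) (y $ 3)"
  by (simp add: sectionB_def quartic_def qform_def eval3_def K_def Y1_def Y2_def Y3_def
      poly_power algebra_simps)

lemma plane_incl_pt:
  assumes "y \<noteq> 0"
  shows "plane_incl l (pt y) = pt (hvec (of_real l * y $ 1) (y $ 1) (y $ 2) (y $ 3))"
proof (rule plane_incl.abs_eq)
  show "proj_rel y y" using assms by (auto simp: proj_rel_def intro: exI[of _ 1])
qed

lemma plane_incl_eqD:
  assumes "plane_incl l p = plane_incl l q"
  shows "p = q"
  using assms
proof (transfer, goal_cases)
  case (1 l p q)
  then show ?case
    unfolding proj_rel_def by (auto simp: vec4_eq_iff vec3_eq_iff)
qed

lemma range_plane_incl: "range (plane_incl l) = planeH l"
proof safe
  fix p :: "3 cproj"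
  obtain y where y: "y \<noteq> 0" "p = pt y"
    by (metis Quotient3_cproj Quotient3_def proj_rel_def)
  then have "hvec (of_real l * y $ 1) (y $ 1) (y $ 2) (y $ 3) \<noteq> 0"
    by (auto simp: vec4_eq_iff vec3_eq_iff)
  then show "plane_incl l p \<in> planeH l"
    unfolding planeH_def y(2) plane_incl_pt[OF y(1)] by force
next
  fix x assume "x \<in> planeH l"
  then obtain y where y: "x = pt y" "y \<noteq> 0" "y $ 0 = of_real l * y $ 1"
    by (auto simp: planeH_def)
  define z :: "complex ^ 3" where "z = vector [y $ 1, y $ 2, y $ 3]"
  have "z \<noteq> 0" using y by (auto simp: z_def vec4_eq_iff vec3_eq_iff)
  moreover have "hvec (of_real l * z $ 1) (z $ 1) (z $ 2) (z $ 3) = y"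
    using y by (simp add: z_def vec4_eq_iff)
  ultimately show "x \<in> range (plane_incl l)" using plane_incl_pt y(1) by (metis rangeI)
qed

end

theory Submission
  imports Defs "HOL-Computational_Algebra.Fundamental_Theorem_Algebra"
begin

text \<open>With \<open>r\<^sup>2 = f\<close> the plane section splits over the complex numbers into the two branches
  \<open>y\<^sub>2 y\<^sub>3 + (Q \<mp> r) y\<^sub>1\<^sup>2 = 0\<close>, which meet only in \<open>P\<^sub>\<infinity>\<close> and its conjugate. Parametrising such a branch,
  with \<open>h = Q \<mp> r\<close>, by \<open>(1 : t : - h / t)\<close>, a conic of generic type restricts to a quartic
  polynomial in \<open>t\<close>, and the touching condition says that all its roots are multiple, so that the
  quartic is a constant times the square of a quadratic polynomial. Comparing coefficients for the
  two branches leaves two cases, according to the relative sign of the constant terms of the two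
  quadratics: with equal signs the conic is a double line, with opposite signs it lies in a family
  with a parameter \<open>s \<noteq> 0\<close>, and \<open>Q\<^sup>2 \<noteq> f\<close>. Invariance under the real structure, tested on a
  point with \<open>y\<^sub>3 = 0\<close>, gives \<open>cnj r = r |s|\<^sup>2\<close>. Hence \<open>|s| = 1\<close> for \<open>f > 0\<close>, and there is no such \<open>s\<close>
  for \<open>f < 0\<close>. For \<open>Q\<^sup>2 = f\<close> one needs \<open>f \<noteq> 0\<close>: otherwise the double root of \<open>Q\<^sup>2 - f\<close> at \<open>\<lambda>\<^sub>0\<close> would
  be a double root of \<open>f\<close>.\<close>

subsection \<open>Homogeneous polynomials in three variables\<close>

lemma K_simps: "K (x + y) = K x + K y" "K (x - y) = K x - K y" "K (x * y) = K x * K y"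
  "K (- x) = - K x" "K 1 = 1" "K 0 = 0" "K (x ^ n) = K x ^ n"
proof -
  show m: "K (x * y) = K x * K y" for x y by (simp add: K_def)
  show o: "K 1 = 1" by (simp add: K_def one_pCons)
  show "K (x ^ n) = K x ^ n" by (induction n) (simp_all add: m o)
qed (simp_all add: K_def)

lemma K_numeral: "K (numeral n) = numeral n"
  by (simp add: K_def numeral_poly)

lemma eval3_simps [simp]:
  "eval3 (A + B) y = eval3 A y + eval3 B y"
  "eval3 (A - B) y = eval3 A y - eval3 B y"
  "eval3 (A * B) y = eval3 A y * eval3 B y"
  "eval3 (- A) y = - eval3 A y"
  "eval3 (A ^ n) y = eval3 A y ^ n"
  "eval3 0 y = 0" "eval3 1 y = 1"
  "eval3 (K c) y = c" "eval3 Y1 y = y $ 1" "eval3 Y2 y = y $ 2" "eval3 Y3 y = y $ 3"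
  by (simp_all add: eval3_def K_def Y1_def Y2_def Y3_def poly_power)

lemma eval3_sum [simp]: "eval3 (\<Sum>i\<in>S. F i) y = (\<Sum>i\<in>S. eval3 (F i) y)"
  by (induction S rule: infinite_finite_induct) auto

section \<open>Expansion into monomials and evaluation\<close>

lemma const_poly_sum: "[:\<Sum>i\<in>S. F i:] = (\<Sum>i\<in>S. [:F i:])"
proof (induction S rule: infinite_finite_induct)
  case (insert x S)
  have "[:F x + sum F S:] = [:F x:] + [:sum F S:]" by simp
  with insert.IH show ?case by (simp only: sum.insert[OF insert.hyps])
qed simp_all

lemma poly_sum_powers: "p = (\<Sum>i\<le>degree p. [:coeff p i:] * [:0, 1:] ^ i)"
proof -
  have "p = (\<Sum>i\<le>degree p. monom (coeff p i) i)"
    by (simp add: poly_as_sum_of_monoms)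
  then show ?thesis
    by (simp add: monom_altdef)
qed

lemma const_poly_mult: "[:(x::'a::comm_semiring_1) * y:] = [:x:] * [:y:]"
  by (simp add: mult.commute)

lemma const_poly_power: "[:(x::'a::comm_semiring_1) ^ n:] = [:x:] ^ n"
  by (simp add: poly_const_pow)

text \<open>A finite index set containing the support. It may include exponents with zero
  coefficient, so arguments over it split on whether the coefficient vanishes.\<close>

definition monom_index :: "cpoly3 \<Rightarrow> (nat \<times> nat \<times> nat) set" where
  "monom_index H = (SIGMA i:{..degree H}. SIGMA j:{..degree (coeff H i)}. {..degree (coeff (coeff H i) j)})"

text \<open>The layers are expanded from the inside out; evaluation and ideal membership can then be
  checked on single monomials.\<close>

lemma cpoly3_expand:
  "H = (\<Sum>(i, j, k)\<in>monom_index H. K (coeff (coeff (coeff H i) j) k) * Y1 ^ i * Y2 ^ j * Y3 ^ k)"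
proof -
  have 1: "[:[:p:]:] = (\<Sum>k\<le>degree p. K (coeff p k) * Y3 ^ k)" for p :: "complex poly"
    by (subst poly_sum_powers)
      (simp only: const_poly_sum const_poly_mult const_poly_power K_def Y3_def)
  have 2: "[:p:] = (\<Sum>j\<le>degree p. \<Sum>k\<le>degree (coeff p j). K (coeff (coeff p j) k) * Y2 ^ j * Y3 ^ k)"
    for p :: "complex poly poly"
  proof -
    have "[:p:] = (\<Sum>j\<le>degree p. [:[:coeff p j:]:] * Y2 ^ j)"
      by (subst poly_sum_powers)
        (simp only: const_poly_sum const_poly_mult const_poly_power Y2_def)
    then show ?thesis
      by (simp only: 1 sum_distrib_left sum_distrib_right mult_ac)
  qed
  have "H = (\<Sum>i\<le>degree H. [:coeff H i:] * Y1 ^ i)"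
    unfolding Y1_def by (rule poly_sum_powers)
  also have "\<dots> = (\<Sum>i\<le>degree H. \<Sum>j\<le>degree (coeff H i). \<Sum>k\<le>degree (coeff (coeff H i) j).
      K (coeff (coeff (coeff H i) j) k) * Y1 ^ i * Y2 ^ j * Y3 ^ k)"
    by (simp only: 2 sum_distrib_left sum_distrib_right mult_ac)
  finally show ?thesis
    unfolding monom_index_def by (simp add: sum.Sigma)
qed

lemma eval3_expand:
  "eval3 H y = (\<Sum>(i, j, k)\<in>monom_index H. coeff (coeff (coeff H i) j) k * y $ 1 ^ i * y $ 2 ^ j * y $ 3 ^ k)"
  by (subst cpoly3_expand) (simp add: case_prod_beta)

lemma homogeneousD: "homogeneous d H \<Longrightarrow> coeff (coeff (coeff H i) j) k \<noteq> 0 \<Longrightarrow> i + j + k = d"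
  by (simp add: homogeneous_def)

lemma eval3_scale:
  assumes "homogeneous d H"
  shows "eval3 H (c *s y) = c ^ d * eval3 H y"
  unfolding eval3_expand sum_distrib_left
proof (rule sum.cong[OF refl], clarify)
  fix i j k
  show "coeff (coeff (coeff H i) j) k * (c *s y) $ 1 ^ i * (c *s y) $ 2 ^ j * (c *s y) $ 3 ^ k =
       c ^ d * (coeff (coeff (coeff H i) j) k * y $ 1 ^ i * y $ 2 ^ j * y $ 3 ^ k)"
  proof (cases "coeff (coeff (coeff H i) j) k = 0")
    case False
    then have "d = i + j + k" using homogeneousD[OF assms] by simp
    then show ?thesis by (simp add: power_mult_distrib power_add)
  qed simp
qed

section \<open>Homogeneity under the ring operations\<close>

lemma homogeneous_mult:
  assumes "homogeneous d A" "homogeneous e B"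
  shows "homogeneous (d + e) (A * B)"
  unfolding homogeneous_def
proof (intro allI impI)
  fix i j k assume "coeff (coeff (coeff (A * B) i) j) k \<noteq> 0"
  then have "(\<Sum>x\<le>i. \<Sum>y\<le>j. \<Sum>z\<le>k. coeff (coeff (coeff A x) y) z *
      coeff (coeff (coeff B (i - x)) (j - y)) (k - z)) \<noteq> 0"
    by (simp add: coeff_mult coeff_sum)
  \<comment> \<open>A nonzero convolution sum has a nonzero summand, and the exponents of its two
    factors add up to \<open>d\<close> and \<open>e\<close>.\<close>
  then obtain x where "x \<le> i" "(\<Sum>y\<le>j. \<Sum>z\<le>k. coeff (coeff (coeff A x) y) z *
      coeff (coeff (coeff B (i - x)) (j - y)) (k - z)) \<noteq> 0"
    by (meson atMost_iff sum.not_neutral_contains_not_neutral)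
  moreover then obtain y where "y \<le> j" "(\<Sum>z\<le>k. coeff (coeff (coeff A x) y) z *
      coeff (coeff (coeff B (i - x)) (j - y)) (k - z)) \<noteq> 0"
    by (meson atMost_iff sum.not_neutral_contains_not_neutral)
  moreover then obtain z where "z \<le> k" "coeff (coeff (coeff A x) y) z *
      coeff (coeff (coeff B (i - x)) (j - y)) (k - z) \<noteq> 0"
    by (meson atMost_iff sum.not_neutral_contains_not_neutral)
  ultimately show "i + j + k = d + e"
    using homogeneousD[OF assms(1), of x y z] homogeneousD[OF assms(2), of "i - x" "j - y" "k - z"]
    by auto
qed

lemma homogeneous_add: "homogeneous d A \<Longrightarrow> homogeneous d B \<Longrightarrow> homogeneous d (A + B)"
  unfolding homogeneous_def by (metis add_0 coeff_add)

lemma homogeneous_uminus: "homogeneous d A \<Longrightarrow> homogeneous d (- A)"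
  unfolding homogeneous_def by auto

lemma homogeneous_diff: "homogeneous d A \<Longrightarrow> homogeneous d B \<Longrightarrow> homogeneous d (A - B)"
  using homogeneous_add[OF _ homogeneous_uminus, of d A B] by simp

lemma homogeneous_K: "homogeneous 0 (K c)"
  and homogeneous_Y1: "homogeneous 1 Y1"
  and homogeneous_Y2: "homogeneous 1 Y2"
  and homogeneous_Y3: "homogeneous 1 Y3"
  by (auto simp: homogeneous_def K_def Y1_def Y2_def Y3_def coeff_pCons split: nat.splits if_splits)

lemma homogeneous_K_mult: "homogeneous d A \<Longrightarrow> homogeneous d (K c * A)"
  using homogeneous_mult[OF homogeneous_K] by force

lemma homogeneous_power2: "homogeneous 1 A \<Longrightarrow> homogeneous 2 (A\<^sup>2)"
  using homogeneous_mult[of 1 A 1 A] by (simp add: power2_eq_square numeral_2_eq_2)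

lemma homogeneous_mult2: "homogeneous 1 A \<Longrightarrow> homogeneous 1 B \<Longrightarrow> homogeneous 2 (A * B)"
  using homogeneous_mult[of 1 A 1 B] by (simp add: numeral_2_eq_2)

lemmas homogeneous_intros = homogeneous_add homogeneous_diff homogeneous_K_mult
  homogeneous_power2 homogeneous_mult2 homogeneous_Y1 homogeneous_Y2 homogeneous_Y3

subsection \<open>Zero sets in the projective plane\<close>

lemma cproj_rep: obtains y where "y \<noteq> 0" "p = pt y"
  by (metis Quotient3_cproj Quotient3_def proj_rel_def)

lemma pt_eq_iff:
  assumes "x \<noteq> 0" "y \<noteq> 0"
  shows "pt x = pt y \<longleftrightarrow> (\<exists>c. c \<noteq> 0 \<and> y = c *s x)"
proof -
  have r: "proj_rel z z" if "z \<noteq> 0" for z :: "complex ^ 'a"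
    using that by (auto simp: proj_rel_def intro: exI[of _ 1])
  have "pt x = pt y \<longleftrightarrow> proj_rel x y"
    using Quotient3_rel[OF Quotient3_cproj, of x y] r assms by blast
  then show ?thesis using assms by (auto simp: proj_rel_def)
qed

text \<open>Homogeneity makes vanishing independent of the representative, whereas
  \<open>zeros\<close> only asks for some representative.\<close>

lemma pt_in_zeros_iff:
  assumes "homogeneous d F" "y \<noteq> 0"
  shows "pt y \<in> zeros F \<longleftrightarrow> eval3 F y = 0"
proof
  assume "pt y \<in> zeros F"
  then obtain z where z: "pt y = pt z" "z \<noteq> 0" "eval3 F z = 0" by (auto simp: zeros_def)
  then obtain c where "c \<noteq> 0" "z = c *s y" using pt_eq_iff assms(2) by blast
  with z eval3_scale[OF assms(1)] show "eval3 F y = 0" by simp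
qed (use assms in \<open>auto simp: zeros_def\<close>)

lemma not_in_zerosD: "pt y \<notin> zeros D \<Longrightarrow> y \<noteq> 0 \<Longrightarrow> eval3 D y \<noteq> 0"
  by (auto simp: zeros_def)

lemma not_in_zeros_nonzero: "p \<notin> zeros D \<Longrightarrow> D \<noteq> 0"
  by (rule cproj_rep[of p]) (auto dest: not_in_zerosD)

text \<open>Modulo the ideal of the affine point \<open>(1 : t : w)\<close>, \<open>Y2\<close>
  becomes \<open>K t * Y1\<close> and \<open>Y3\<close> becomes \<open>K w * Y1\<close>, so a form
  of degree \<open>d\<close> becomes a constant times \<open>Y1 ^ d\<close>. A form vanishing at the
  point therefore lies in the ideal of the two lines.\<close>

lemma homogeneous_linear_comb_ideal:
  assumes "homogeneous d H"
  obtains M N where "H = M * (Y2 - K t * Y1) + N * (Y3 - K w * Y1)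
    + Y1 ^ d * K (eval3 H (vector [1, t, w]))"
proof -
  let ?u = "Y2 - K t * Y1" and ?v = "Y3 - K w * Y1"
  define J where "J = {M * ?u + N * ?v | M N. True}"
  have J0: "0 \<in> J" unfolding J_def by (intro CollectI exI[of _ 0]) simp
  have J_intro: "M * ?u + N * ?v \<in> J" for M N unfolding J_def by blast
  have J_add: "x + y \<in> J" if xy: "x \<in> J" "y \<in> J" for x y
  proof -
    from xy obtain M N M' N' where "x = M * ?u + N * ?v" "y = M' * ?u + N' * ?v"
      unfolding J_def by blast
    then have "x + y = (M + M') * ?u + (N + N') * ?v" by (simp only: distrib_right add_ac)
    then show ?thesis using J_intro by metis
  qed
  have J_mult: "x * y \<in> J" if y: "y \<in> J" for x y
  proof -
    from y obtain M N where "y = M * ?u + N * ?v"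
      unfolding J_def by blast
    then have "x * y = (x * M) * ?u + (x * N) * ?v" by (simp only: distrib_left mult.assoc)
    then show ?thesis using J_intro by metis
  qed
  have uJ: "?u \<in> J" using J_intro[of 1 0] by simp
  have vJ: "?v \<in> J" using J_intro[of 0 1] by simp
  \<comment> \<open>\<open>x - y\<close> divides \<open>x ^ n - y ^ n\<close>.\<close>
  have J_power: "x ^ n - y ^ n \<in> J" if "x - y \<in> J" for x y n
    using J_mult[OF that, of "\<Sum>i<n. y ^ (n - Suc i) * x ^ i"]
    by (simp add: power_diff_sumr2 mult.commute)
  have J_monom: "K c * Y1 ^ i * Y2 ^ j * Y3 ^ k - Y1 ^ (i + j + k) * K (c * t ^ j * w ^ k) \<in> J"
    for c i j k
  proof -
    \<comment> \<open>\<open>Y2\<close> is replaced first, then \<open>Y3\<close>; each of the two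
      differences is a multiple of one generator.\<close>
    have "K c * Y1 ^ i * Y2 ^ j * Y3 ^ k - Y1 ^ (i + j + k) * K (c * t ^ j * w ^ k)
      = (K c * Y1 ^ i * Y3 ^ k) * (Y2 ^ j - (K t * Y1) ^ j)
        + (K c * Y1 ^ i * (K t * Y1) ^ j) * (Y3 ^ k - (K w * Y1) ^ k)"
      by (simp only: K_simps power_mult_distrib power_add) (simp only: algebra_simps)
    then show ?thesis using J_add J_mult J_power uJ vJ by metis
  qed
  have J_sum: "(\<Sum>x\<in>S. g x) \<in> J" if "\<And>x. x \<in> S \<Longrightarrow> g x \<in> J" for S :: "(nat \<times> nat \<times> nat) set" and g
    using that by (induction S rule: infinite_finite_induct) (auto intro: J0 J_add)
  let ?c = "\<lambda>i j k. coeff (coeff (coeff H i) j) k"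
  have "H - Y1 ^ d * K (eval3 H (vector [1, t, w])) =
    (\<Sum>(i, j, k)\<in>monom_index H. K (?c i j k) * Y1 ^ i * Y2 ^ j * Y3 ^ k)
    - Y1 ^ d * K (\<Sum>(i, j, k)\<in>monom_index H. ?c i j k * t ^ j * w ^ k)"
    by (subst cpoly3_expand[of H]) (simp add: eval3_expand)
  also have "\<dots> = (\<Sum>x\<in>monom_index H. case x of (i, j, k) \<Rightarrow>
      K (?c i j k) * Y1 ^ i * Y2 ^ j * Y3 ^ k - Y1 ^ d * K (?c i j k * t ^ j * w ^ k))"
  proof -
    have "K (\<Sum>x\<in>S. g x) = (\<Sum>x\<in>S. K (g x))" for S :: "(nat \<times> nat \<times> nat) set" and g
      by (induction S rule: infinite_finite_induct) (simp_all add: K_simps)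
    then show ?thesis
      by (simp add: sum_distrib_left sum_subtractf case_prod_beta)
  qed
  also have "\<dots> \<in> J"
  proof (rule J_sum, clarify)
    fix i j k
    show "K (?c i j k) * Y1 ^ i * Y2 ^ j * Y3 ^ k - Y1 ^ d * K (?c i j k * t ^ j * w ^ k) \<in> J"
    proof (cases "?c i j k = 0")
      case False
      then show ?thesis using homogeneousD[OF assms] J_monom by metis
    qed (simp add: K_simps J0)
  qed
  finally show thesis
    using that unfolding J_def by (auto simp: algebra_simps)
qed

subsection \<open>Estimates for local intersection numbers\<close>

text \<open>A form \<open>E\<close> not vanishing at the point is a unit of the local ring, so
  membership may be tested on \<open>A * E\<close>.\<close>

lemma Fract_in_local_ideal:
  assumes "A * E = M * F + N * G" "homogeneous d A" "homogeneous d D" "homogeneous e E"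
    and y: "y \<noteq> 0" "eval3 D y \<noteq> 0" "eval3 E y \<noteq> 0"
  shows "Fract A D \<in> local_ideal F G (pt y)"
proof -
  have "E \<noteq> 0" using y(3) by auto
  then have "Fract A D = Fract (M * F + N * G) (D * E)"
    unfolding assms(1)[symmetric] using mult_fract_cancel[of E A D] by (simp add: mult.commute)
  moreover have "homogeneous (d + e) (D * E)" "homogeneous (d + e) (M * F + N * G)"
    using homogeneous_mult assms(1-4) by (metis, metis)
  moreover have "pt y \<notin> zeros (D * E)"
    using pt_in_zeros_iff[OF \<open>homogeneous (d + e) (D * E)\<close>] y by auto
  ultimately show ?thesis unfolding local_ideal_def by blast
qed

text \<open>Isolates the condition under the supremum in \<open>local_int\<close>, so that bounds
  can be proved for one set at a time.\<close>

definition independent_mod :: "cpoly3 \<Rightarrow> cpoly3 \<Rightarrow> 3 cproj \<Rightarrow> cpoly3 fract set \<Rightarrow> bool" where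
  "independent_mod F G p S \<longleftrightarrow> finite S \<and> S \<subseteq> local_ring p \<and>
     (\<forall>c. (\<Sum>s\<in>S. Fract (K (c s)) 1 * s) \<in> local_ideal F G p \<longrightarrow> (\<forall>s\<in>S. c s = 0))"

lemma independent_modD:
  assumes "independent_mod F G p S"
  shows "finite S" "S \<subseteq> local_ring p"
    "(\<Sum>s\<in>S. Fract (K (c s)) 1 * s) \<in> local_ideal F G p \<Longrightarrow> s \<in> S \<Longrightarrow> c s = 0"
  using assms unfolding independent_mod_def by blast+

lemma local_int_leI: "(\<And>S. independent_mod F G p S \<Longrightarrow> card S \<le> n) \<Longrightarrow> local_int F G p \<le> enat n"
  unfolding local_int_def independent_mod_def[symmetric] by (rule Sup_least) auto

lemma local_int_geI: "independent_mod F G p S \<Longrightarrow> enat (card S) \<le> local_int F G p"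
  unfolding local_int_def independent_mod_def[symmetric] by (rule Sup_upper) blast

text \<open>\<open>F\<close> is a unit of the local ring, so the ideal is the whole ring and no
  element is independent modulo it.\<close>

lemma local_int_eq_0:
  assumes "homogeneous d F" "y \<noteq> 0" "eval3 F y \<noteq> 0"
  shows "local_int F G (pt y) = 0"
proof -
  have "S = {}" if S: "independent_mod F G (pt y) S" for S
  proof (rule ccontr)
    assume "S \<noteq> {}"
    then obtain s where s: "s \<in> S" by auto
    then obtain A D n where AD: "s = Fract A D" "homogeneous n A" "homogeneous n D" "pt y \<notin> zeros D"
      using independent_modD(2)[OF S] unfolding local_ring_def by auto
    \<comment> \<open>Taking the indicator function of \<open>s\<close> as coefficients reduces the
      combination to \<open>s\<close> itself.\<close>
    have "(\<Sum>x\<in>S. Fract (K (if x = s then 1 else 0)) 1 * x)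
        = (\<Sum>x\<in>S. if x = s then s else 0)"
      by (rule sum.cong) (auto simp: K_simps One_fract_def[symmetric] fract_collapse)
    then have "(\<Sum>x\<in>S. Fract (K (if x = s then 1 else 0)) 1 * x) = s"
      using independent_modD(1)[OF S] s by simp
    moreover have "s \<in> local_ideal F G (pt y)"
      unfolding AD(1)
      by (rule Fract_in_local_ideal[of _ F A _ 0, OF _ AD(2,3) assms(1,2) not_in_zerosD[OF AD(4)] assms(3)])
        (use assms in auto)
    ultimately show False
      using independent_modD(3)[OF S, of "\<lambda>x. if x = s then 1 else 0" s] s by simp
  qed
  then have "local_int F G (pt y) \<le> enat 0" by (metis card.empty le_refl local_int_leI)
  then show ?thesis by (simp add: zero_enat_def[symmetric])
qed

text \<open>The hypothesis says that, up to units, every form vanishing at the point lies in the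
  ideal. The ideal then contains the maximal ideal, modulo which the local ring is
  one-dimensional.\<close>

lemma local_int_le_1:
  assumes y: "y \<noteq> 0"
    and E: "\<And>d H. homogeneous d H \<Longrightarrow> eval3 H y = 0 \<Longrightarrow>
      \<exists>E M N e. H * E = M * F + N * G \<and> homogeneous e E \<and> eval3 E y \<noteq> 0"
  shows "local_int F G (pt y) \<le> 1"
proof -
  have "card S \<le> 1" if S: "independent_mod F G (pt y) S" for S
  proof (rule ccontr)
    assume "\<not> card S \<le> 1"
    then obtain s1 s2 where s: "s1 \<in> S" "s2 \<in> S" "s1 \<noteq> s2"
      using card_le_Suc0_iff_eq[OF independent_modD(1)[OF S]] by auto
    obtain A1 D1 n1 where 1: "s1 = Fract A1 D1" "homogeneous n1 A1" "homogeneous n1 D1" "pt y \<notin> zeros D1"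
      using independent_modD(2)[OF S] s unfolding local_ring_def by auto
    obtain A2 D2 n2 where 2: "s2 = Fract A2 D2" "homogeneous n2 A2" "homogeneous n2 D2" "pt y \<notin> zeros D2"
      using independent_modD(2)[OF S] s unfolding local_ring_def by auto
    \<comment> \<open>Chosen so that the numerator of the combination of \<open>s1\<close> and
      \<open>s2\<close> over the common denominator \<open>D1 * D2\<close> vanishes at
      \<open>y\<close>.\<close>
    obtain c1 c2 :: complex where c: "c1 * (eval3 A1 y * eval3 D2 y) + c2 * (eval3 A2 y * eval3 D1 y) = 0"
      "c1 \<noteq> 0 \<or> c2 \<noteq> 0"
    proof (cases "eval3 A1 y * eval3 D2 y = 0 \<and> eval3 A2 y * eval3 D1 y = 0")
      case True
      then show thesis using that[of 1 0] by auto
    next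
      case False
      then show thesis
        using that[of "eval3 A2 y * eval3 D1 y" "- (eval3 A1 y * eval3 D2 y)"] by auto
    qed
    define c where "c = (\<lambda>s. if s = s1 then c1 else if s = s2 then c2 else 0)"
    let ?H = "K c1 * (A1 * D2) + K c2 * (A2 * D1)"
    have D: "D1 \<noteq> 0" "D2 \<noteq> 0" "eval3 D1 y \<noteq> 0" "eval3 D2 y \<noteq> 0"
      using 1 2 y by (auto dest: not_in_zeros_nonzero not_in_zerosD)
    have H: "homogeneous (n1 + n2) ?H"
      using homogeneous_mult[OF 1(2) 2(3)] homogeneous_mult[OF 2(2) 1(3)]
      by (auto intro!: homogeneous_intros simp: add.commute)
    obtain E M N e where EMN: "?H * E = M * F + N * G" "homogeneous e E" "eval3 E y \<noteq> 0"
      using E[OF H] c(1) by auto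
    have "(\<Sum>s\<in>S. Fract (K (c s)) 1 * s) = (\<Sum>s\<in>{s1, s2}. Fract (K (c s)) 1 * s)"
      by (rule sum.mono_neutral_right) (use independent_modD(1)[OF S] s in \<open>auto simp: c_def K_simps fract_collapse\<close>)
    also have "\<dots> = Fract ?H (D1 * D2)"
      using s(3) D by (simp add: c_def 1(1) 2(1) algebra_simps)
    also have "\<dots> \<in> local_ideal F G (pt y)"
      by (rule Fract_in_local_ideal[OF EMN(1) H homogeneous_mult[OF 1(3) 2(3)] EMN(2) y _ EMN(3)])
        (use D in auto)
    finally have "c s1 = 0" "c s2 = 0" using independent_modD(3)[OF S] s by blast+
    then show False using c(2) s(3) by (auto simp: c_def split: if_splits)
  qed
  then show ?thesis using local_int_leI[of F G "pt y" 1] by (simp add: one_enat_def)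
qed

text \<open>All elements of the ideal vanish at a common point of the curves, so the constant
  \<open>1\<close> is independent modulo it.\<close>

lemma local_int_pos:
  assumes "y \<noteq> 0" "eval3 F y = 0" "eval3 G y = 0"
  shows "local_int F G (pt y) \<noteq> 0"
proof -
  have h1: "homogeneous 0 1" using homogeneous_K[of 1] by (simp add: K_simps)
  have n1: "pt y \<notin> zeros 1" using pt_in_zeros_iff[OF h1 assms(1)] by simp
  have 1: "1 \<in> local_ring (pt y)"
    unfolding local_ring_def using h1 n1 by (auto simp: One_fract_def)
  have "c = 0" if c: "Fract (K c) 1 \<in> local_ideal F G (pt y)" for c
  proof -
    from c obtain M N D d where MN: "Fract (K c) 1 = Fract (M * F + N * G) D" "pt y \<notin> zeros D"
      unfolding local_ideal_def by blast
    then have "K c * D = M * F + N * G"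
      using eq_fract(1)[of 1 D "K c" "M * F + N * G"] not_in_zeros_nonzero by auto
    then have "eval3 (K c * D) y = 0" using assms by simp
    then show "c = 0" using not_in_zerosD[OF MN(2) assms(1)] by simp
  qed
  then have "independent_mod F G (pt y) {1}"
    using 1 by (simp add: independent_mod_def)
  then have "enat 1 \<le> local_int F G (pt y)"
    using local_int_geI by fastforce
  then show ?thesis by (auto simp: zero_enat_def)
qed

section \<open>Lower bound two at points of common tangency\<close>

lemma continuous_eval3:
  assumes "\<And>i. continuous_on UNIV (\<lambda>x. g x $ i)"
  shows "continuous_on UNIV (\<lambda>x. eval3 H (g x))"
  unfolding eval3_expand case_prod_beta
  by (intro continuous_intros assms)

text \<open>The two independent elements are \<open>1\<close> and the coordinate \<open>y\<^sub>2 / y\<^sub>1 - t\<close>: along a common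
  tangent direction of the two curves every element of the ideal vanishes to second order.\<close>

lemma local_int_ge_2:
  fixes t w w' :: complex
  assumes F: "\<And>e. eval3 F (vector [1, t + e, w + e * w']) = e\<^sup>2 * kF e"
    and G: "\<And>e. eval3 G (vector [1, t + e, w + e * w']) = e\<^sup>2 * kG e"
    and k: "continuous_on UNIV kF" "continuous_on UNIV kG"
  shows "local_int F G (pt (vector [1, t, w])) \<ge> 2"
proof -
  define y :: "complex ^ 3" where "y = vector [1, t, w]"
  define g :: "complex \<Rightarrow> complex ^ 3" where "g = (\<lambda>e. vector [1, t + e, w + e * w'])"
  have y0: "y \<noteq> 0" by (simp add: y_def vec3_eq_iff)
  have "continuous_on UNIV (\<lambda>e. g e $ i)" for i
    using exhaust_3[of i] by (elim disjE) (simp_all add: g_def continuous_intros)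
  then have cont: "continuous_on UNIV (\<lambda>e. eval3 H (g e))" for H by (rule continuous_eval3)
  have g0: "g 0 = y" by (simp add: g_def y_def)
  \<comment> \<open>Continuous functions that agree away from \<open>0\<close> agree at
    \<open>0\<close>; this allows cancelling a factor \<open>e\<close> before setting
    \<open>e = 0\<close>.\<close>
  have zero: "a = b" if "continuous_on UNIV p" "continuous_on UNIV q" "p 0 = a" "q 0 = b"
    "\<And>e. e \<noteq> 0 \<Longrightarrow> p e = q e" for p q :: "complex \<Rightarrow> complex" and a b
  proof -
    have "(p \<longlongrightarrow> a) (at 0)" "(q \<longlongrightarrow> b) (at 0)"
      using that(1-4) by (auto simp: continuous_on_def)
    moreover have "(p \<longlongrightarrow> a) (at 0) \<longleftrightarrow> (q \<longlongrightarrow> a) (at 0)"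
      by (rule filterlim_cong) (auto simp: eventually_at that(5) intro!: exI[of _ 1])
    ultimately show ?thesis using tendsto_unique[of "at 0" q a b] by simp
  qed
  define u where "u = Y2 - K t * Y1"
  define s where "s = Fract u Y1"
  have h1: "homogeneous 0 1" using homogeneous_K[of 1] by (simp add: K_simps)
  have n1: "pt y \<notin> zeros 1" using pt_in_zeros_iff[OF h1 y0] by simp
  have nY: "pt y \<notin> zeros Y1" using pt_in_zeros_iff[OF homogeneous_Y1 y0] by (simp add: y_def)
  have Y0: "Y1 \<noteq> 0" by (simp add: Y1_def)
  have 1: "1 \<in> local_ring (pt y)"
    unfolding local_ring_def using h1 n1 by (auto simp: One_fract_def)
  have s: "s \<in> local_ring (pt y)"
    unfolding local_ring_def s_def u_def using nY by (auto intro!: homogeneous_intros)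
  have s1: "s \<noteq> 1"
  proof
    assume "s = 1"
    then have "u = Y1" using Y0 by (simp add: s_def One_fract_def eq_fract)
    then have "eval3 u y = eval3 Y1 y" by simp
    then show False by (simp add: u_def y_def)
  qed
  have "a = 0 \<and> b = 0" if ab: "Fract (K a) 1 + Fract (K b) 1 * s \<in> local_ideal F G (pt y)" for a b
  proof -
    from ab obtain M N D d where MN: "Fract (K a) 1 + Fract (K b) 1 * s = Fract (M * F + N * G) D"
        "pt y \<notin> zeros D"
      unfolding local_ideal_def by blast
    have D: "D \<noteq> 0" "eval3 D y \<noteq> 0" using MN(2) y0 by (auto dest: not_in_zeros_nonzero not_in_zerosD)
    have "Fract (K a) 1 + Fract (K b) 1 * s = Fract (K a * Y1 + K b * u) Y1"
      using Y0 by (simp add: s_def)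
    with MN(1) have "(K a * Y1 + K b * u) * D = (M * F + N * G) * Y1"
      using D Y0 by (simp add: eq_fract)
    then have eq: "eval3 ((K a * Y1 + K b * u) * D) (g e) = eval3 ((M * F + N * G) * Y1) (g e)" for e
      by simp
    define h where "h = (\<lambda>e. eval3 M (g e) * kF e + eval3 N (g e) * kG e)"
    have h: "continuous_on UNIV h" unfolding h_def by (intro continuous_intros cont k)
    have eq': "(a + b * e) * eval3 D (g e) = e\<^sup>2 * h e" for e
      using eq[of e] F[of e] G[of e] by (simp add: u_def h_def g_def algebra_simps)
    \<comment> \<open>Order zero in \<open>e\<close> gives \<open>a = 0\<close>; after division by
      \<open>e\<close> the next order gives \<open>b = 0\<close>.\<close>
    from eq'[of 0] have a: "a = 0" using D(2) by (simp add: g0)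
    have "b * eval3 D y = 0"
    proof (rule zero)
      show "b * eval3 D (g e) = e * h e" if "e \<noteq> 0" for e
        using eq'[of e] that by (simp add: a power2_eq_square)
    qed (auto intro!: continuous_intros cont h simp: g0)
    with a D(2) show ?thesis by simp
  qed
  then have "independent_mod F G (pt y) {1, s}"
    using 1 s s1 by (simp add: independent_mod_def)
  then have "enat (card {1, s}) \<le> local_int F G (pt y)"
    by (rule local_int_geI)
  then show ?thesis using s1 by (simp add: y_def numeral_eq_enat numeral_2_eq_2)
qed

subsection \<open>Conics touching both branches\<close>

definition conic :: "complex \<Rightarrow> complex \<Rightarrow> complex \<Rightarrow> complex \<Rightarrow> complex \<Rightarrow> complex \<Rightarrow> cpoly3" where
  "conic a b c d e g =
     K a * Y1\<^sup>2 + K b * (Y1 * Y2) + K c * (Y1 * Y3) + K d * Y2\<^sup>2 + K e * (Y2 * Y3) + K g * Y3\<^sup>2"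

lemma homogeneous_conic: "homogeneous 2 (conic a b c d e g)"
  unfolding conic_def by (intro homogeneous_intros)

lemma eval3_conic: "eval3 (conic a b c d e g) y =
    a * (y $ 1)\<^sup>2 + b * (y $ 1 * y $ 2) + c * (y $ 1 * y $ 3) + d * (y $ 2)\<^sup>2
    + e * (y $ 2 * y $ 3) + g * (y $ 3)\<^sup>2"
  by (simp add: conic_def)

lemma conic_pCons: "conic a b c d e g =
    [:[:[:0, 0, g:], [:0, e:], [:d:]:], [:[:0, c:], [:b:]:], [:[:a:]:]:]"
  by (simp add: conic_def K_def Y1_def Y2_def Y3_def power2_eq_square)

lemma homogeneous_2_conic:
  assumes "homogeneous 2 F"
  obtains a b c d e g where "F = conic a b c d e g"
proof
  let ?c = "\<lambda>i j k. coeff (coeff (coeff F i) j) k"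
  have zero: "?c i j k = 0" if "i + j + k \<noteq> 2" for i j k
    using homogeneousD[OF assms] that by blast
  show "F = conic (?c 2 0 0) (?c 1 1 0) (?c 1 0 1) (?c 0 2 0) (?c 0 1 1) (?c 0 0 2)"
    unfolding conic_pCons
    by (intro poly_eqI)
      (auto simp: coeff_pCons zero numeral_2_eq_2 split: nat.splits)
qed

text \<open>A conic through \<open>(1 : t : w)\<close> is written in the ideal of that point. At the
  point the two cofactors are the partial derivatives with respect to \<open>y\<close> and
  \<open>z\<close>.\<close>

lemma conic_tangent_expansion:
  fixes a b c d e g t w x y z :: "'a::idom"
  assumes "a + b * t + c * w + d * t\<^sup>2 + e * (t * w) + g * w\<^sup>2 = 0"
  shows "a * x\<^sup>2 + b * (x * y) + c * (x * z) + d * y\<^sup>2 + e * (y * z) + g * z\<^sup>2 =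
    (d * (y + t * x) + b * x + e * z) * (y - t * x) + (g * (z + w * x) + c * x + e * t * x) * (z - w * x)"
  using assms by algebra

text \<open>Cramer's rule for the linear system that expresses \<open>F\<close> and the branch
  factor of \<open>G\<close> through \<open>u\<close> and \<open>v\<close>; the determinant is
  \<open>y2 * L1 - w * x * L2\<close>. Multiplication by \<open>G2\<close> turns the branch factor
  into \<open>G\<close>.\<close>

lemma ideal_identity:
  fixes F G L1 L2 u v y2 x w G2 :: "'a::idom"
  assumes "F = L1 * u + L2 * v" "G = (y2 * v + w * x * u) * G2" "H = M * u + N * v"
  shows "H * (y2 * (y2 * L1 - w * x * L2) * G2) =
    (y2 * M * y2 * G2 - N * w * x * y2 * G2) * F
    + (N * (y2 * L1 - w * x * L2) + N * w * x * L2 - y2 * M * L2) * G"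
  unfolding assms by algebra

text \<open>The factor \<open>t * (\<dots>) - w * (\<dots>)\<close> is, up to a scalar, the derivative of the conic along the
  branch \<open>y\<^sub>2 y\<^sub>3 = t w y\<^sub>1\<^sup>2\<close> of \<open>G = 0\<close>: if it does not vanish, the two curves are transversal.\<close>

lemma local_int_transversal:
  fixes t w :: complex
  defines "p \<equiv> vector [1, t, w] :: complex ^ 3"
  assumes t: "t \<noteq> 0" and F0: "eval3 (conic a b c d e g) p = 0"
    and G: "G = (Y2 * Y3 - K (t * w) * Y1\<^sup>2) * G2" "homogeneous 2 G2" "eval3 G2 p \<noteq> 0"
    and tr: "t * (b + 2 * d * t + e * w) - w * (c + e * t + 2 * g * w) \<noteq> 0"
  shows "local_int (conic a b c d e g) G (pt p) \<le> 1"
proof (rule local_int_le_1)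
  show "p \<noteq> 0" by (simp add: p_def vec3_eq_iff)
next
  fix n H assume H: "homogeneous n H" "eval3 H p = 0"
  \<comment> \<open>\<open>L1\<close> and \<open>L2\<close> are the cofactors of the tangent
    expansion, and \<open>E\<close> is the Cramer determinant; its value at \<open>p\<close> is the
    expression in \<open>tr\<close>.\<close>
  define L1 where "L1 = K d * (Y2 + K t * Y1) + K b * Y1 + K e * Y3"
  define L2 where "L2 = K g * (Y3 + K w * Y1) + K c * Y1 + K e * K t * Y1"
  define E where "E = Y2 * L1 - K w * Y1 * L2"
  obtain M N where MN: "H = M * (Y2 - K t * Y1) + N * (Y3 - K w * Y1) + Y1 ^ n * K (eval3 H p)"
    unfolding p_def by (rule homogeneous_linear_comb_ideal[OF H(1)])
  have "K (a + b * t + c * w + d * t\<^sup>2 + e * (t * w) + g * w\<^sup>2) = 0"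
    using F0 by (simp add: eval3_conic p_def K_simps(6))
  then have F: "conic a b c d e g = L1 * (Y2 - K t * Y1) + L2 * (Y3 - K w * Y1)"
    unfolding conic_def L1_def L2_def by (intro conic_tangent_expansion) (simp only: K_simps)
  have G': "G = (Y2 * (Y3 - K w * Y1) + K w * Y1 * (Y2 - K t * Y1)) * G2"
    unfolding G(1) K_simps by algebra
  have "H = M * (Y2 - K t * Y1) + N * (Y3 - K w * Y1)"
    using MN H(2) by (simp add: K_simps)
  then have "\<exists>M' N'. H * (Y2 * E * G2) = M' * conic a b c d e g + N' * G"
    unfolding E_def using ideal_identity[OF F G'] by blast
  moreover have L: "homogeneous 1 L1" "homogeneous 1 L2"
    unfolding L1_def L2_def mult.assoc by (intro homogeneous_intros)+
  have "homogeneous 2 E"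
    unfolding E_def mult.assoc by (intro homogeneous_intros L)
  then have "homogeneous (1 + 2 + 2) (Y2 * E * G2)"
    by (intro homogeneous_mult homogeneous_Y2 G(2))
  moreover have "eval3 (Y2 * E * G2) p \<noteq> 0"
  proof -
    have "eval3 (Y2 * E * G2) p =
        t * (t * (b + 2 * d * t + e * w) - w * (c + e * t + 2 * g * w)) * eval3 G2 p"
      by (simp add: E_def L1_def L2_def p_def algebra_simps)
    then show ?thesis using t G(3) tr by simp
  qed
  ultimately show "\<exists>E M N m. H * E = M * conic a b c d e g + N * G \<and> homogeneous m E \<and> eval3 E p \<noteq> 0"
    by blast
qed

text \<open>Over the complex numbers there are four linear factors. When every root is multiple they
  pair up, leaving \<open>A * (t^2 + p t + q)^2\<close>.\<close>

lemma quartic_all_roots_multiple: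
  fixes A B C D E :: complex
  assumes A: "A \<noteq> 0"
    and roots: "\<And>t. A * t ^ 4 + B * t ^ 3 + C * t\<^sup>2 + D * t + E = 0 \<Longrightarrow>
      4 * A * t ^ 3 + 3 * B * t\<^sup>2 + 2 * C * t + D = 0"
  obtains p q where "B = 2 * A * p" "C = A * (p\<^sup>2 + 2 * q)" "D = 2 * A * p * q" "E = A * q\<^sup>2"
proof -
  let ?p = "[:E, D, C, B, A:]"
  have ev: "poly ?p t = A * t ^ 4 + B * t ^ 3 + C * t\<^sup>2 + D * t + E" for t
    by (simp add: algebra_simps power_numeral_reduce)
  have "?p \<noteq> 0" using A by simp
  then obtain R where "size R = degree ?p" "?p = smult (lead_coeff ?p) (\<Prod>x\<in>#R. [:- x, 1:])"
    using alg_closed_imp_factorization by blast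
  then have R: "size R = 4" "?p = smult A (\<Prod>x\<in>#R. [:- x, 1:])"
    using A by simp_all
  obtain xs where xs: "R = mset xs" by (metis ex_mset)
  with R(1) obtain x1 x2 x3 x4 where "xs = [x1, x2, x3, x4]"
    by (auto simp: numeral_eq_Suc length_Suc_conv)
  with xs have x: "R = {#x1, x2, x3, x4#}" by simp
  have "?p = smult A ([:- x1, 1:] * ([:- x2, 1:] * ([:- x3, 1:] * [:- x4, 1:])))"
    using R(2) by (simp add: x)
  then have co: "E = A * (x1 * x2 * x3 * x4)"
    "D = - A * (x1 * x2 * x3 + x1 * x2 * x4 + x1 * x3 * x4 + x2 * x3 * x4)"
    "C = A * (x1 * x2 + x1 * x3 + x1 * x4 + x2 * x3 + x2 * x4 + x3 * x4)"
    "B = - A * (x1 + x2 + x3 + x4)"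
    by (simp_all add: algebra_simps)
  \<comment> \<open>The derivative at a root is \<open>A\<close> times the product of its
    differences to the other roots.\<close>
  have d1: "(x1 - x2) * (x1 - x3) * (x1 - x4) = 0"
    using roots[of x1] A unfolding co by algebra
  have d2: "(x2 - x1) * (x2 - x3) * (x2 - x4) = 0"
    using roots[of x2] A unfolding co by algebra
  have d3: "(x3 - x1) * (x3 - x2) * (x3 - x4) = 0"
    using roots[of x3] A unfolding co by algebra
  have d4: "(x4 - x1) * (x4 - x2) * (x4 - x3) = 0"
    using roots[of x4] A unfolding co by algebra
  note decomposition = that
  \<comment> \<open>\<open>p\<close> and \<open>q\<close> are the coefficients of
    \<open>(t - x) * (t - y)\<close>.\<close>
  have pairs: thesis if "B = - A * (x + x + y + y)" "C = A * (x * x + x * y + x * y + x * y + x * y + y * y)"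
    "D = - A * (x * x * y + x * x * y + x * y * y + x * y * y)" "E = A * (x * x * y * y)" for x y
    by (rule decomposition[of "- (x + y)" "x * y"])
      (simp_all add: that algebra_simps power2_eq_square)
  from d1 d2 d3 d4 consider "x1 = x2" "x3 = x4" | "x1 = x3" "x2 = x4" | "x1 = x4" "x2 = x3"
    by auto
  then show thesis
  proof cases
    case 1 then show thesis by (intro pairs[of x1 x3]) (simp_all add: co algebra_simps)
  next
    case 2 then show thesis by (intro pairs[of x1 x2]) (simp_all add: co algebra_simps)
  next
    case 3 then show thesis by (intro pairs[of x1 x2]) (simp_all add: co algebra_simps)
  qed
qed

lemma conic_square: "conic (a * p\<^sup>2) (2 * a * p) (2 * a * p * m) a (2 * a * m) (a * m\<^sup>2) =
    (K (a * p) * Y1 + K a * Y2 + K (a * m) * Y3) * (K p * Y1 + Y2 + K m * Y3)"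
  unfolding conic_def K_simps K_numeral by algebra

lemma not_unit_if_zero: "eval3 L y = 0 \<Longrightarrow> \<not> L dvd 1"
proof
  assume "eval3 L y = 0" "L dvd 1"
  then obtain M where "1 = L * M" by (auto simp: dvd_def)
  then have "eval3 1 y = eval3 L y * eval3 M y" by (metis eval3_simps(3))
  then show False using \<open>eval3 L y = 0\<close> by simp
qed

text \<open>Both linear factors vanish at the origin, so neither is a unit. This rules out the
  double line.\<close>

lemma conic_square_not_irreducible:
  "\<not> irreducible (conic (a * p\<^sup>2) (2 * a * p) (2 * a * p * m) a (2 * a * m) (a * m\<^sup>2))"
proof
  assume "irreducible (conic (a * p\<^sup>2) (2 * a * p) (2 * a * p * m) a (2 * a * m) (a * m\<^sup>2))"
  then have "K (a * p) * Y1 + K a * Y2 + K (a * m) * Y3 dvd 1 \<or> K p * Y1 + Y2 + K m * Y3 dvd 1"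
    using irreducibleD[OF _ conic_square] by blast
  then show False
    using not_unit_if_zero[of _ "vector [0, 0, 0]"] by (auto simp del: eval3_simps(8))
qed

text \<open>\<open>d\<close> and \<open>g\<close> are the values of the conic at the conjugate of
  \<open>P_inf\<close> and at \<open>P_inf\<close>, so generic type makes them nonzero. A complex
  \<open>r\<close> serves both signs of \<open>f\<close>.\<close>

lemma touching_conic_coeffs:
  fixes Q r :: complex
  defines "G \<equiv> (Y2 * Y3 + K (Q - r) * Y1\<^sup>2) * (Y2 * Y3 + K (Q + r) * Y1\<^sup>2)"
  assumes irr: "irreducible (conic a b c d e g)" and dg: "d \<noteq> 0" "g \<noteq> 0" and r: "r \<noteq> 0"
    and touch: "\<And>t w. eval3 (conic a b c d e g) (vector [1, t, w]) = 0 \<Longrightarrow>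
      eval3 G (vector [1, t, w]) = 0 \<Longrightarrow> local_int (conic a b c d e g) G (pt (vector [1, t, w])) \<ge> 2"
  obtains k s where "k \<noteq> 0" "s \<noteq> 0" "Q\<^sup>2 \<noteq> r\<^sup>2"
    "conic a b c d e g = conic (k * (2 * (Q\<^sup>2 - r\<^sup>2))) 0 0 (k * (r / s)) (k * (2 * Q)) (k * (r * s))"
proof -
  \<comment> \<open>Clearing denominators in the conic at \<open>(1, t, - h / t)\<close> gives
    \<open>d t^4 + b t^3 + (a - h e) t^2 - h c t + h^2 g\<close>, which is to be
    \<open>d (t^2 + p t + q)^2\<close>.\<close>
  have branch: "\<exists>p q. b = 2 * d * p \<and> a - h * e = d * (p\<^sup>2 + 2 * q) \<and> - h * c = 2 * d * p * q \<and> h\<^sup>2 * g = d * q\<^sup>2"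
    if h: "h = Q - r \<or> h = Q + r" for h
  proof -
    have "4 * d * t ^ 3 + 3 * b * t\<^sup>2 + 2 * (a - h * e) * t + (- h * c) = 0"
      if root: "d * t ^ 4 + b * t ^ 3 + (a - h * e) * t\<^sup>2 + (- h * c) * t + h\<^sup>2 * g = 0" for t
    proof (cases "t = 0")
      \<comment> \<open>\<open>t = 0\<close> lies outside the parametrisation. As
        \<open>g \<noteq> 0\<close>, it is a root only for \<open>h = 0\<close>, and then the
        quartic is divisible by \<open>t^2\<close>.\<close>
      case True
      then have "h = 0" using root dg by simp
      then show ?thesis using True by simp
    next
      case False
      define w where "w = - h / t"
      have tw: "t * w = - h" using False by (simp add: w_def)
      \<comment> \<open>\<open>h'\<close> belongs to the other branch; \<open>r \<noteq> 0\<close>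
        keeps that branch away from this point.\<close>
      obtain h' where h': "h' \<noteq> h" "G = (Y2 * Y3 - K (t * w) * Y1\<^sup>2) * (Y2 * Y3 + K h' * Y1\<^sup>2)"
      proof (cases "h = Q - r")
        case True
        have "G = (Y2 * Y3 - K (t * w) * Y1\<^sup>2) * (Y2 * Y3 + K (Q + r) * Y1\<^sup>2)"
          unfolding G_def tw True K_simps by algebra
        then show thesis using that[of "Q + r"] r True by simp
      next
        case False
        then have "h = Q + r" using h by simp
        have "G = (Y2 * Y3 - K (t * w) * Y1\<^sup>2) * (Y2 * Y3 + K (Q - r) * Y1\<^sup>2)"
          unfolding G_def tw \<open>h = Q + r\<close> K_simps by algebra
        then show thesis using that[of "Q - r"] False by auto
      qed
      have "t\<^sup>2 * eval3 (conic a b c d e g) (vector [1, t, w]) =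
          d * t ^ 4 + b * t ^ 3 + (a + (t * w) * e) * t\<^sup>2 + (t * w) * c * t + (t * w)\<^sup>2 * g"
        by (simp add: eval3_conic algebra_simps power2_eq_square power_numeral_reduce)
      also have "\<dots> = 0" using root unfolding tw by simp
      finally have F0: "eval3 (conic a b c d e g) (vector [1, t, w]) = 0"
        using False by simp
      have G0: "eval3 G (vector [1, t, w]) = 0" unfolding h'(2) by simp
      have ge: "\<not> local_int (conic a b c d e g) G (pt (vector [1, t, w])) \<le> 1"
      proof
        assume "local_int (conic a b c d e g) G (pt (vector [1, t, w])) \<le> 1"
        with touch[OF F0 G0] have "(2::enat) \<le> 1" by (rule order.trans)
        then show False by simp
      qed
      have "t * (b + 2 * d * t + e * w) - w * (c + e * t + 2 * g * w) = 0"
      proof (rule ccontr)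
        assume tr: "t * (b + 2 * d * t + e * w) - w * (c + e * t + 2 * g * w) \<noteq> 0"
        have "homogeneous 2 (Y2 * Y3 + K h' * Y1\<^sup>2)" by (intro homogeneous_intros)
        moreover have "eval3 (Y2 * Y3 + K h' * Y1\<^sup>2) (vector [1, t, w]) \<noteq> 0"
          using h'(1) by (simp add: tw)
        ultimately show False
          using local_int_transversal[OF False F0 h'(2) _ _ tr] ge by blast
      qed
      \<comment> \<open>With denominators cleared, the tangency relation plus twice the root
        equation is \<open>t\<close> times the derivative of the quartic.\<close>
      then have "t\<^sup>2 * (t * (b + 2 * d * t + e * w) - w * (c + e * t + 2 * g * w)) = 0" by simp
      then have "b * t ^ 3 + 2 * d * t ^ 4 - (t * w) * c * t - 2 * g * (t * w)\<^sup>2 = 0" by algebra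
      then have "b * t ^ 3 + 2 * d * t ^ 4 + h * c * t - 2 * g * h\<^sup>2 = 0" by (simp add: tw)
      then have "t * (4 * d * t ^ 3 + 3 * b * t\<^sup>2 + 2 * (a - h * e) * t + (- h * c)) = 0"
        using root by algebra
      then show ?thesis using False by simp
    qed
    then show ?thesis using quartic_all_roots_multiple[OF dg(1), of b "a - h * e" "- h * c" "h\<^sup>2 * g"] by metis
  qed
  obtain p q1 where 1: "b = 2 * d * p" "a - (Q - r) * e = d * (p\<^sup>2 + 2 * q1)"
    "- (Q - r) * c = 2 * d * p * q1" "(Q - r)\<^sup>2 * g = d * q1\<^sup>2"
    using branch[of "Q - r"] by auto
  obtain p' q2 where 2: "b = 2 * d * p'" "a - (Q + r) * e = d * (p'\<^sup>2 + 2 * q2)"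
    "- (Q + r) * c = 2 * d * p' * q2" "(Q + r)\<^sup>2 * g = d * q2\<^sup>2"
    using branch[of "Q + r"] by auto
  have "p' = p" using 1(1) 2(1) dg(1) by simp
  note 2 = 2[unfolded this]
  \<comment> \<open>With this square root of \<open>g / d\<close>, the constant terms are
    \<open>(Q - r) * m\<close> and \<open>(Q + r) * m\<close> up to sign.\<close>
  define m where "m = csqrt (g / d)"
  have m2: "g = d * m\<^sup>2" using dg by (simp add: m_def)
  have m0: "m \<noteq> 0" using dg m2 by auto
  have "d * (q1\<^sup>2 - ((Q - r) * m)\<^sup>2) = 0" "d * (q2\<^sup>2 - ((Q + r) * m)\<^sup>2) = 0"
    using 1(4) 2(4) unfolding m2 by algebra+
  then have q: "q1 = (Q - r) * m \<or> q1 = - ((Q - r) * m)" "q2 = (Q + r) * m \<or> q2 = - ((Q + r) * m)"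
    using dg(1) by (auto simp: power2_eq_iff)
  \<comment> \<open>Equal signs, with the common sign absorbed into \<open>n\<close>: the
    comparisons for the two branches determine all coefficients, and they are those of a double
    line.\<close>
  have same: False if n: "n\<^sup>2 = m\<^sup>2" "q1 = - ((Q - r) * n)" "q2 = - ((Q + r) * n)" for n
  proof -
    have "2 * r * (e - 2 * d * n) = 0" using 1(2) 2(2) unfolding n(2,3) by algebra
    then have e: "e = 2 * d * n" using r by simp
    have a: "a = d * p\<^sup>2" using 1(2) unfolding n(2) e by algebra
    have "2 * r * (c - 2 * d * p * n) = 0" using 1(3) 2(3) unfolding n(2,3) by algebra
    then have c: "c = 2 * d * p * n" using r by simp
    have "g = d * n\<^sup>2" using m2 n by simp
    then show False using irr conic_square_not_irreducible[of d p n] a c e 1(1) by simp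
  qed
  note coeffs = that
  have opp: thesis if n: "n\<^sup>2 = m\<^sup>2" "q1 = - ((Q - r) * n)" "q2 = (Q + r) * n" for n
  proof -
    have n0: "n \<noteq> 0" using n(1) m0 by auto
    \<comment> \<open>If one of the two constants vanishes, its sign is ambiguous, and the excluded
      case of equal signs applies.\<close>
    have c1: "Q - r \<noteq> 0" using same[of "- n"] n by auto
    have c2: "Q + r \<noteq> 0" using same[of n] n by auto
    have "(Q - r) * (c - 2 * d * p * n) = 0" "(Q + r) * (c + 2 * d * p * n) = 0"
      using 1(3) 2(3) unfolding n(2,3) by algebra+
    then have "c - 2 * d * p * n = 0" "c + 2 * d * p * n = 0" using c1 c2 by auto
    then have "c = 0" "d * p * n = 0" by algebra+
    then have p0: "c = 0" "p = 0" "b = 0" using n0 dg 1(1) by auto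
    have "2 * (r * e + 2 * d * n * Q) = 0" using 1(2) 2(2) unfolding n(2,3) by algebra
    then have re: "r * e = - 2 * d * n * Q" by algebra
    \<comment> \<open>Read off from \<open>d = k * (r / s)\<close> with the parameter
      \<open>s = - n\<close>.\<close>
    define k where "k = - d * n / r"
    have k: "k * r = - d * n" using r by (simp add: k_def)
    have "r * (e - k * (2 * Q)) = 0" using re k by algebra
    then have e: "e = k * (2 * Q)" using r by simp
    have a: "a = k * (2 * (Q\<^sup>2 - r\<^sup>2))"
    proof -
      have a: "a = (Q - r) * e - 2 * (Q - r) * (d * n)"
        using 1(2) unfolding n(2) p0 by (simp add: algebra_simps)
      also have "d * n = - (k * r)" using k by simp
      finally show ?thesis unfolding e by (simp add: algebra_simps power2_eq_square)
    qed
    have d: "d = k * (r / (- n))" using k n0 by (simp add: field_simps)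
    have g: "g = k * (r * (- n))" using k m2 n(1) by algebra
    have Q: "Q\<^sup>2 \<noteq> r\<^sup>2" using c1 c2 by (auto simp: power2_eq_iff add_eq_0_iff)
    have k0: "k \<noteq> 0" using k dg n0 r by auto
    have "conic a b c d e g =
      conic (k * (2 * (Q\<^sup>2 - r\<^sup>2))) 0 0 (k * (r / (- n))) (k * (2 * Q)) (k * (r * (- n)))"
      by (simp only: a p0 d e g)
    then show thesis using coeffs[of k "- n"] k0 n0 Q by simp
  qed
  from q show thesis
    using same[of m] same[of "- m"] opp[of m] opp[of "- m"] by auto
qed

text \<open>As a polynomial in \<open>y1\<close> this is \<open>a y1^2 + q\<close> with a unit as
  leading coefficient, so a proper factorisation has two linear factors. It would make
  \<open>q\<close> a constant times a square, forcing its discriminant to vanish.\<close>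

lemma irreducible_conic:
  assumes a: "a \<noteq> 0" and d: "d \<noteq> 0" and disc: "e\<^sup>2 \<noteq> 4 * d * g"
  shows "irreducible (conic a 0 0 d e g)"
proof (rule irreducibleI)
  define q where "q = [:[:0, 0, g:], [:0, e:], [:d:]:]"
  have F: "conic a 0 0 d e g = [:q, 0, [:[:a:]:]:]"
    by (simp add: conic_pCons q_def)
  show "conic a 0 0 d e g \<noteq> 0" using a by (simp add: F)
  show "\<not> conic a 0 0 d e g dvd 1"
    by (rule not_unit_if_zero[of _ 0]) (simp add: eval3_conic)
  fix M N assume MN: "conic a 0 0 d e g = M * N"
  have nz: "M \<noteq> 0" "N \<noteq> 0" using MN a by (auto simp: F)
  have deg: "degree M + degree N = 2"
    using degree_mult_eq[OF nz] a unfolding MN[symmetric] by (simp add: F)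
  have lc: "lead_coeff M * lead_coeff N = [:[:a:]:]"
    using lead_coeff_mult[of M N] a unfolding MN[symmetric] by (simp add: F)
  have "[:[:a:]:] dvd 1" using a by (simp add: is_unit_const_poly_iff dvd_field_iff)
  then have u: "lead_coeff M dvd 1" "lead_coeff N dvd 1"
    unfolding lc[symmetric] by (auto simp: is_unit_mult_iff)
  consider "degree M = 0" | "degree N = 0" | "degree M = 1" "degree N = 1"
    using deg by linarith
  then show "M dvd 1 \<or> N dvd 1"
  proof cases
    case 1
    then show ?thesis using u(1) by (metis degree_0_id is_unit_const_poly_iff)
  next
    case 2
    then show ?thesis using u(2) by (metis degree_0_id is_unit_const_poly_iff)
  next
    case 3
    obtain m0 m1 where M: "M = [:m0, m1:]" using 3 by (metis degree1_coeffs)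
    obtain n0 n1 where N: "N = [:n0, n1:]" using 3 by (metis degree1_coeffs)
    have "[:q, 0, [:[:a:]:]:] = [:m0 * n0, m0 * n1 + m1 * n0, m1 * n1:]"
      using MN unfolding F M N by (simp add: algebra_simps)
    then have co: "q = m0 * n0" "0 = m0 * n1 + m1 * n0" "[:[:a:]:] = m1 * n1" by simp_all
    have "m1 dvd 1" using u(1) 3 by (simp add: M split: if_splits)
    then obtain \<mu> where \<mu>: "m1 = [:[:\<mu>:]:]" "\<mu> \<noteq> 0"
      by (auto simp: is_unit_poly_iff dvd_field_iff)
    \<comment> \<open>The vanishing \<open>y1\<close>-coefficient of the product eliminates
      \<open>n0\<close> and \<open>n1\<close>.\<close>
    have key: "q * m1\<^sup>2 = - [:[:a:]:] * m0\<^sup>2" unfolding co(3) using co(1,2) by algebra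
    have "degree (q * m1\<^sup>2) = 2"
      using \<mu> d by (simp add: q_def power2_eq_square)
    moreover have "degree (- [:[:a:]:] * m0\<^sup>2) = 2 * degree m0"
      using a by (cases "m0 = 0") (simp_all add: degree_power_eq)
    ultimately have "degree m0 = 1" using key by simp
    then obtain x y where xy: "m0 = [:x, y:]" by (metis degree1_coeffs)
    have "[:[:\<mu>\<^sup>2:] * [:0, 0, g:], [:\<mu>\<^sup>2:] * [:0, e:], [:\<mu>\<^sup>2:] * [:d:]:] =
        [:- [:a:] * x\<^sup>2, - [:a:] * (x * y + x * y), - [:a:] * y\<^sup>2:]"
      using key by (simp add: q_def \<mu> xy power2_eq_square algebra_simps smult_add_left[symmetric])
    then have 1: "[:\<mu>\<^sup>2:] * [:0, 0, g:] = - [:a:] * x\<^sup>2" "[:\<mu>\<^sup>2:] * [:0, e:] = - [:a:] * (x * y + x * y)"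
      "[:\<mu>\<^sup>2:] * [:d:] = - [:a:] * y\<^sup>2"
      by (simp_all only: pCons_eq_iff)
    \<comment> \<open>Evaluation at \<open>y3 = 1\<close> leaves scalar identities that together
      contradict \<open>disc\<close>.\<close>
    have ev: "\<mu>\<^sup>2 * g = - a * (poly x 1)\<^sup>2" "\<mu>\<^sup>2 * e = - 2 * a * poly x 1 * poly y 1"
      "\<mu>\<^sup>2 * d = - a * (poly y 1)\<^sup>2"
      using 1[THEN arg_cong[of _ _ "\<lambda>p. poly p 1"]] by (simp_all add: poly_power mult_ac)
    have "(\<mu>\<^sup>2)\<^sup>2 * (e\<^sup>2 - 4 * d * g) = 0" using ev by algebra
    then show ?thesis using \<mu>(2) disc by simp
  qed
qed

subsection \<open>The real structure and the circle of touching conics\<close>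

lemma real_str_pt:
  "y \<noteq> 0 \<Longrightarrow> real_str (pt y) = pt (hvec (cnj (y $ 0)) (cnj (y $ 1)) (cnj (y $ 3)) (cnj (y $ 2)))"
  by (rule real_str.abs_eq) (auto simp: proj_rel_def intro: exI[of _ 1])

lemma hvec_eq_0_iff: "hvec a b c d = 0 \<longleftrightarrow> a = 0 \<and> b = 0 \<and> c = 0 \<and> d = 0"
  by (simp add: vec4_eq_iff)

lemma real_str_plane_incl:
  assumes "y \<noteq> 0"
  shows "real_str (plane_incl l (pt y)) =
    plane_incl l (pt (vector [cnj (y $ 1), cnj (y $ 3), cnj (y $ 2)]))"
proof -
  have "(vector [cnj (y $ 1), cnj (y $ 3), cnj (y $ 2)] :: complex ^ 3) \<noteq> 0"
    and "hvec (of_real l * y $ 1) (y $ 1) (y $ 2) (y $ 3) \<noteq> 0"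
    using assms by (auto simp: vec3_eq_iff hvec_eq_0_iff)
  then show ?thesis using assms by (simp add: plane_incl_pt real_str_pt)
qed

lemma plane_incl_in_image: "plane_incl l p \<in> plane_incl l ` S \<longleftrightarrow> p \<in> S"
  using plane_incl_eqD by auto

lemma plane_incl_in_conic:
  assumes "conic_equation l C F" "y \<noteq> 0"
  shows "plane_incl l (pt y) \<in> C \<longleftrightarrow> eval3 F y = 0"
  using assms pt_in_zeros_iff by (auto simp: conic_equation_def plane_incl_in_image)

lemma plane_incl_in_surfaceB:
  assumes "y \<noteq> 0"
  shows "plane_incl l (pt y) \<in> surfaceB a b q0 q1 q2 \<longleftrightarrow> eval3 (sectionB a b q0 q1 q2 l) y = 0"
proof -
  let ?h = "hvec (of_real l * y $ 1) (y $ 1) (y $ 2) (y $ 3)"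
  let ?q = "\<lambda>z. quartic (of_real a) (of_real b) (of_real q0) (of_real q1) (of_real q2)
    (z $ 0) (z $ 1) (z $ 2) (z $ 3) :: complex"
  have h: "?h \<noteq> 0" using assms by (auto simp: vec3_eq_iff hvec_eq_0_iff)
  have hom: "?q (c *s z) = c ^ 4 * ?q z" for c z
    by (simp add: quartic_def qform_def algebra_simps power2_eq_square power_numeral_reduce)
  have "pt ?h \<in> surfaceB a b q0 q1 q2 \<longleftrightarrow> ?q ?h = 0"
  proof
    assume "pt ?h \<in> surfaceB a b q0 q1 q2"
    then obtain z where z: "pt ?h = pt z" "z \<noteq> 0" "?q z = 0" by (auto simp: surfaceB_def)
    then obtain c where "c \<noteq> 0" "z = c *s ?h" using pt_eq_iff h by blast
    with z(3) hom[of c ?h] show "?q ?h = 0" by (metis mult_eq_0_iff power_not_zero)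
  qed (use h in \<open>auto simp: surfaceB_def\<close>)
  then show ?thesis using assms by (simp add: plane_incl_pt eval3_sectionB)
qed

lemma P_inf_eq: "P_inf = plane_incl l (pt (vector [0, 0, 1]))"
  and P_inf_bar_eq: "P_inf_bar = plane_incl l (pt (vector [0, 1, 0]))"
  by (subst plane_incl_pt; simp add: P_inf_def P_inf_bar_def vec3_eq_iff)+

lemma eval3_sectionB':
  "eval3 (sectionB a b q0 q1 q2 l) y =
    (y $ 2 * y $ 3 + of_real (qform q0 q1 q2 l 1) * (y $ 1)\<^sup>2)\<^sup>2 - of_real (cubic a b l) * (y $ 1) ^ 4"
  by (simp add: sectionB_eq)

text \<open>The plane section passes through both points, so an intersection number there is zero
  exactly when \<open>C\<close> avoids the point. Equations of \<open>C\<close> share their zeros,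
  so the choice of equation does not matter.\<close>

lemma generic_type_iff:
  assumes C: "conic_equation l C F"
  shows "generic_type a b q0 q1 q2 l C \<longleftrightarrow> P_inf \<notin> C \<and> P_inf_bar \<notin> C"
proof
  assume "generic_type a b q0 q1 q2 l C"
  then obtain F' where F': "conic_equation l C F'"
    "\<And>p. plane_incl l p \<in> {P_inf, P_inf_bar} \<Longrightarrow> local_int F' (sectionB a b q0 q1 q2 l) p = 0"
    by (auto simp: generic_type_def)
  have "plane_incl l (pt y) \<notin> C"
    if y: "y \<noteq> 0" "eval3 (sectionB a b q0 q1 q2 l) y = 0" "plane_incl l (pt y) \<in> {P_inf, P_inf_bar}" for y
    using local_int_pos[OF y(1) _ y(2)] F'(2)[OF y(3)] plane_incl_in_conic[OF F'(1) y(1)] by blast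
  from this[of "vector [0, 0, 1]"] this[of "vector [0, 1, 0]"]
  show "P_inf \<notin> C \<and> P_inf_bar \<notin> C"
    by (simp add: P_inf_eq[of l] P_inf_bar_eq[of l] eval3_sectionB' vec3_eq_iff)
next
  assume nin: "P_inf \<notin> C \<and> P_inf_bar \<notin> C"
  have "local_int F (sectionB a b q0 q1 q2 l) p = 0" if p: "plane_incl l p \<in> {P_inf, P_inf_bar}" for p
  proof -
    obtain y where y: "y \<noteq> 0" "p = pt y" by (rule cproj_rep)
    have "eval3 F y \<noteq> 0" using p nin plane_incl_in_conic[OF C y(1)] y(2) by auto
    then show ?thesis
      using C y by (auto simp: conic_equation_def intro: local_int_eq_0)
  qed
  then show "generic_type a b q0 q1 q2 l C" using C by (auto simp: generic_type_def)
qed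

text \<open>The comparison of coefficients gives the shape up to \<open>s\<close>; reality of
  \<open>D\<close>, tested at one point with \<open>y3 = 0\<close>, then ties \<open>s\<close> to
  \<open>r\<close>.\<close>

lemma touching_generic_conic:
  assumes touch: "real_touching_conic a b q0 q1 q2 l D" and gen: "generic_type a b q0 q1 q2 l D"
    and Q: "Q = qform q0 q1 q2 l 1" and r: "r\<^sup>2 = of_real (cubic a b l)" "r \<noteq> 0"
  obtains k s where "k \<noteq> 0" "s \<noteq> 0" "Q\<^sup>2 \<noteq> cubic a b l" "cnj r = r * (s * cnj s)"
    "D = plane_incl l ` zeros (conic (k * (2 * ((of_real Q)\<^sup>2 - r\<^sup>2))) 0 0 (k * (r / s)) (k * (2 * of_real Q)) (k * (r * s)))"
proof -
  let ?G = "sectionB a b q0 q1 q2 l"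
  obtain F where F: "conic_equation l D F" and real: "real_set D"
    and tch: "D \<subseteq> surfaceB a b q0 q1 q2 \<or>
      (\<forall>p. plane_incl l p \<in> D \<inter> surfaceB a b q0 q1 q2 \<longrightarrow> local_int F ?G p \<ge> 2)"
    using touch by (auto simp: real_touching_conic_def)
  have irr: "irreducible F" and D: "D = plane_incl l ` zeros F" and hom: "homogeneous 2 F"
    using F by (auto simp: conic_equation_def)
  obtain x1 x2 x3 d e g where Fc: "F = conic x1 x2 x3 d e g"
    using homogeneous_2_conic[OF hom] .
  have "P_inf \<notin> D" "P_inf_bar \<notin> D" using gen generic_type_iff[OF F] by auto
  then have dg: "d \<noteq> 0" "g \<noteq> 0"
    using plane_incl_in_conic[OF F, of "vector [0, 1, 0]"] plane_incl_in_conic[OF F, of "vector [0, 0, 1]"]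
    by (auto simp: P_inf_eq[of l] P_inf_bar_eq[of l] vec3_eq_iff Fc eval3_conic)
  \<comment> \<open>On \<open>y1 = 0\<close> the surface requires \<open>y2 y3 = 0\<close>, so a
    conic inside it would meet this line only in the two points excluded by generic type.\<close>
  have "\<not> D \<subseteq> surfaceB a b q0 q1 q2"
  proof
    assume sub: "D \<subseteq> surfaceB a b q0 q1 q2"
    have "\<not> constant (poly [:g, e, d:])" using dg by (simp add: constant_degree)
    then obtain t where t: "poly [:g, e, d:] t = 0"
      using fundamental_theorem_of_algebra by blast
    have v: "(vector [0, t, 1] :: complex ^ 3) \<noteq> 0" by (simp add: vec3_eq_iff)
    have "plane_incl l (pt (vector [0, t, 1])) \<in> D"
      using t unfolding plane_incl_in_conic[OF F v]
      by (simp add: Fc eval3_conic algebra_simps power2_eq_square)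
    then have "eval3 ?G (vector [0, t, 1]) = 0"
      using sub plane_incl_in_surfaceB[OF v] by blast
    then have "t = 0" by (simp add: eval3_sectionB')
    then show False using t dg by simp
  qed
  with tch have tch': "local_int F ?G (pt y) \<ge> 2" if "y \<noteq> 0" "eval3 F y = 0" "eval3 ?G y = 0" for y
    using that plane_incl_in_conic[OF F] plane_incl_in_surfaceB by blast
  have G: "?G = (Y2 * Y3 + K (of_real Q - r) * Y1\<^sup>2) * (Y2 * Y3 + K (of_real Q + r) * Y1\<^sup>2)"
    unfolding sectionB_eq Q[symmetric] r(1)[symmetric] K_simps by algebra
  have "(2::enat) \<le> local_int (conic x1 x2 x3 d e g)
      ((Y2 * Y3 + K (of_real Q - r) * Y1\<^sup>2) * (Y2 * Y3 + K (of_real Q + r) * Y1\<^sup>2)) (pt (vector [1, t, w]))"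
    if "eval3 (conic x1 x2 x3 d e g) (vector [1, t, w]) = 0"
      "eval3 ((Y2 * Y3 + K (of_real Q - r) * Y1\<^sup>2) * (Y2 * Y3 + K (of_real Q + r) * Y1\<^sup>2)) (vector [1, t, w]) = 0"
    for t w
    using tch'[of "vector [1, t, w]"] that unfolding Fc G by (simp add: vec3_eq_iff)
  from touching_conic_coeffs[OF irr[unfolded Fc] dg r(2) this]
  obtain k s where ks: "k \<noteq> 0" "s \<noteq> 0" "(of_real Q)\<^sup>2 \<noteq> r\<^sup>2"
    "F = conic (k * (2 * ((of_real Q)\<^sup>2 - r\<^sup>2))) 0 0 (k * (r / s)) (k * (2 * of_real Q)) (k * (r * s))"
    unfolding Fc by metis
  define X where "X = Q\<^sup>2 - cubic a b l"
  have X: "(of_real Q)\<^sup>2 - r\<^sup>2 = of_real X" by (simp add: X_def r(1))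
  have X0: "X \<noteq> 0" using ks(3) X by auto
  \<comment> \<open>Solves \<open>2 X + (r / s) w^2 = 0\<close>, so that \<open>(1 : w : 0)\<close>
    lies on the conic.\<close>
  define w where "w = csqrt (- (2 * of_real X * s / r))"
  have w2: "w\<^sup>2 = - (2 * of_real X * s / r)" by (simp add: w_def)
  have v: "(vector [1, w, 0] :: complex ^ 3) \<noteq> 0" "(vector [1, 0, cnj w] :: complex ^ 3) \<noteq> 0"
    by (simp_all add: vec3_eq_iff)
  have "eval3 F (vector [1, w, 0]) = 0"
    unfolding ks(4) X using ks(2) r(2) by (simp add: eval3_conic w2)
  then have "plane_incl l (pt (vector [1, w, 0])) \<in> D"
    using plane_incl_in_conic[OF F v(1)] by simp
  \<comment> \<open>The conjugate point \<open>(1 : 0 : cnj w)\<close> gives a second equation; as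
    \<open>X\<close> is real and nonzero, it cancels against the conjugate of the first.\<close>
  then have "real_str (plane_incl l (pt (vector [1, w, 0]))) \<in> D"
    using real unfolding real_set_def by blast
  then have "plane_incl l (pt (vector [1, 0, cnj w])) \<in> D"
    using real_str_plane_incl[OF v(1), of l] by simp
  then have "eval3 F (vector [1, 0, cnj w]) = 0"
    using plane_incl_in_conic[OF F v(2)] by simp
  then have "k * (2 * of_real X + r * s * (cnj w)\<^sup>2) = 0"
    unfolding ks(4) X by (simp add: eval3_conic algebra_simps)
  then have "2 * of_real X + r * s * cnj (w\<^sup>2) = 0" using ks(1) by simp
  then have "2 * of_real X * (cnj r - r * s * cnj s) = 0"
    unfolding w2 using r(2) by (simp add: field_simps)
  then have "cnj r = r * (s * cnj s)" using X0 by (simp add: mult.assoc)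
  moreover have "Q\<^sup>2 \<noteq> cubic a b l" using X0 by (simp add: X_def)
  ultimately show thesis using that[of k s] ks D by simp
qed

section \<open>The members of the family, indexed by the unit circle\<close>

lemma family_form_eq_conic:
  "family_form Q f \<theta> = conic (of_real (2 * (Q\<^sup>2 - f))) 0 0 (of_real (sqrt f) * exp (\<i> * of_real \<theta>))
     (of_real (2 * Q)) (of_real (sqrt f) * cnj (exp (\<i> * of_real \<theta>)))"
  by (simp add: family_form_def conic_def K_simps(6) exp_cnj mult.assoc)

text \<open>Indexed by the point \<open>u = exp (\<i> * of_real \<theta>)\<close> instead of an
  angle, with \<open>r\<close> standing for \<open>sqrt f\<close>; on the unit circle
  \<open>cnj u\<close> is the inverse of \<open>u\<close>.\<close>

definition unit_conic :: "real \<Rightarrow> real \<Rightarrow> complex \<Rightarrow> cpoly3" where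
  "unit_conic Q r u = conic (of_real (2 * (Q\<^sup>2 - r\<^sup>2))) 0 0 (of_real r * u) (of_real (2 * Q)) (of_real r * cnj u)"

lemma eval3_unit_conic: "eval3 (unit_conic Q r u) y = 2 * ((of_real Q)\<^sup>2 - (of_real r)\<^sup>2) * (y $ 1)\<^sup>2
    + of_real r * u * (y $ 2)\<^sup>2 + 2 * of_real Q * (y $ 2 * y $ 3) + of_real r * cnj u * (y $ 3)\<^sup>2"
  by (simp add: unit_conic_def eval3_conic)

lemma unit_conic_equation:
  assumes "r \<noteq> 0" "Q\<^sup>2 \<noteq> r\<^sup>2" "norm u = 1"
  shows "conic_equation l (plane_incl l ` zeros (unit_conic Q r u)) (unit_conic Q r u)"
proof -
  have u: "u * cnj u = 1" using assms(3) by (simp add: complex_norm_square[symmetric])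
  have "4 * (of_real r * u) * (of_real r * cnj u) = 4 * (of_real r)\<^sup>2 * (u * cnj u)"
    by (simp add: power2_eq_square)
  also have "\<dots> = complex_of_real (4 * r\<^sup>2)" by (simp add: u)
  finally have "(of_real (2 * Q))\<^sup>2 \<noteq> 4 * (of_real r * u) * (of_real r * cnj u)"
    using assms(2) by (simp only: of_real_power[symmetric] of_real_eq_iff) simp
  then have "irreducible (unit_conic Q r u)"
    unfolding unit_conic_def
    by (rule irreducible_conic[rotated 2]) (use assms in \<open>auto simp flip: of_real_diff of_real_power\<close>)
  then show ?thesis by (simp add: conic_equation_def homogeneous_conic unit_conic_def)
qed

text \<open>The conics are compared on the line \<open>y1 = 0\<close>. If
  \<open>u \<noteq> v\<close>, both intersection points \<open>(0 : t : 1)\<close> satisfy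
  \<open>t^2 u v = 1\<close>, so the two values of \<open>t\<close> have equal squares; this
  contradicts \<open>Q d \<noteq> 0\<close>.\<close>

lemma unit_conic_inj:
  assumes r: "r > 0" and Q: "Q \<noteq> 0" "Q\<^sup>2 > r\<^sup>2" and uv: "norm u = 1" "norm v = 1"
    and eq: "zeros (unit_conic Q r u) = zeros (unit_conic Q r v)"
  shows "u = v"
proof (rule ccontr)
  assume "u \<noteq> v"
  have u: "u * cnj u = 1" and v: "v * cnj v = 1"
    using uv by (simp_all add: complex_norm_square[symmetric])
  have u0: "u \<noteq> 0" using u by auto
  define d where "d = sqrt (Q\<^sup>2 - r\<^sup>2)"
  have d: "d\<^sup>2 = Q\<^sup>2 - r\<^sup>2" "d \<noteq> 0" using Q by (auto simp: d_def)
  have root: "t\<^sup>2 * (u * v) = 1" if t: "t = (- of_real Q + of_real h) / (of_real r * u)" "h\<^sup>2 = d\<^sup>2" for t h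
  proof -
    have rut: "of_real r * u * t = - of_real Q + of_real h" using t r u0 by (simp add: field_simps)
    have h2: "(of_real h)\<^sup>2 = (of_real Q)\<^sup>2 - (complex_of_real r)\<^sup>2"
      using t(2) d(1) by (metis of_real_diff of_real_power)
    have "of_real r * u * (of_real r * u * t\<^sup>2 + 2 * of_real Q * t + of_real r * cnj u) = 0"
      using rut h2 u by algebra
    then have 1: "of_real r * u * t\<^sup>2 + 2 * of_real Q * t + of_real r * cnj u = 0"
      using r u0 by simp
    have n: "(vector [0, t, 1] :: complex ^ 3) \<noteq> 0" by (simp add: vec3_eq_iff)
    have hom: "homogeneous 2 (unit_conic Q r z)" for z by (simp add: unit_conic_def homogeneous_conic)
    have "pt (vector [0, t, 1]) \<in> zeros (unit_conic Q r u)"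
      unfolding pt_in_zeros_iff[OF hom n] using 1 by (simp add: eval3_unit_conic)
    then have "pt (vector [0, t, 1]) \<in> zeros (unit_conic Q r v)" using eq by simp
    then have 2: "of_real r * v * t\<^sup>2 + 2 * of_real Q * t + of_real r * cnj v = 0"
      unfolding pt_in_zeros_iff[OF hom n] by (simp add: eval3_unit_conic)
    \<comment> \<open>The difference of the two equations, with \<open>cnj u\<close> and
      \<open>cnj v\<close> replaced by inverses.\<close>
    have "of_real r * ((u - v) * (t\<^sup>2 * (u * v) - 1)) = 0"
      using 1 2 u v by algebra
    then show ?thesis using r \<open>u \<noteq> v\<close> by simp
  qed
  have 1: "((- of_real Q + of_real d) / (of_real r * u))\<^sup>2 * (u * v) = 1" by (rule root[OF refl, of d]) simp
  have 2: "((- of_real Q + of_real (- d)) / (of_real r * u))\<^sup>2 * (u * v) = 1" by (rule root[OF refl, of "- d"]) simp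
  have v0: "v \<noteq> 0" using v by auto
  have "((- of_real Q + of_real d) / (of_real r * u))\<^sup>2 = ((- of_real Q + of_real (- d)) / (of_real r * u))\<^sup>2"
    using 1 2 u0 v0 by (metis mult_cancel_right no_zero_divisors)
  then have "(- of_real Q + of_real d)\<^sup>2 = (- of_real Q + complex_of_real (- d))\<^sup>2"
    using r u0 by (simp add: power_divide)
  then have "of_real (Q * d) = (0 :: complex)" by (simp add: power2_eq_square algebra_simps)
  then show False using Q d by simp
qed

text \<open>The coefficients are conjugate-symmetric under exchange of \<open>y2\<close> and
  \<open>y3\<close>, which gives reality. On each branch the equation is essentially a square, so
  conic and section share a tangent direction at every common point.\<close>

lemma unit_conic_touching:
  assumes Q: "Q = qform q0 q1 q2 l 1" and r: "r\<^sup>2 = cubic a b l" "r > 0" "Q\<^sup>2 > r\<^sup>2" and u1: "norm u = 1"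
  shows "real_touching_conic a b q0 q1 q2 l (plane_incl l ` zeros (unit_conic Q r u))"
    and "generic_type a b q0 q1 q2 l (plane_incl l ` zeros (unit_conic Q r u))"
proof -
  let ?F = "unit_conic Q r u" and ?G = "sectionB a b q0 q1 q2 l"
  let ?C = "plane_incl l ` zeros ?F"
  have u: "u * cnj u = 1" using u1 by (simp add: complex_norm_square[symmetric])
  have u0: "u \<noteq> 0" using u by auto
  have C: "conic_equation l ?C ?F" using unit_conic_equation r u1 by simp
  show "generic_type a b q0 q1 q2 l ?C"
    unfolding generic_type_iff[OF C] using r(2) u0
    by (auto simp: P_inf_eq[of l] P_inf_bar_eq[of l] plane_incl_in_conic[OF C] vec3_eq_iff eval3_unit_conic)
  have conj: "real_str x \<in> ?C" if "x \<in> ?C" for x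
  proof -
    from that obtain p where "x = plane_incl l p" "p \<in> zeros ?F" by auto
    then obtain y where y: "y \<noteq> 0" "x = plane_incl l (pt y)" by (metis cproj_rep)
    have n: "(vector [cnj (y $ 1), cnj (y $ 3), cnj (y $ 2)] :: complex ^ 3) \<noteq> 0"
      using y(1) by (auto simp: vec3_eq_iff)
    have "eval3 ?F (vector [cnj (y $ 1), cnj (y $ 3), cnj (y $ 2)]) = cnj (eval3 ?F y)"
      by (simp add: eval3_unit_conic algebra_simps)
    then show ?thesis
      using that plane_incl_in_conic[OF C n] plane_incl_in_conic[OF C y(1)]
      by (simp add: y(2) real_str_plane_incl[OF y(1)])
  qed
  have invol: "real_str (real_str x) = x" for x
  proof -
    obtain y where y: "y \<noteq> 0" "x = pt y" by (rule cproj_rep)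
    have "hvec (cnj (y $ 0)) (cnj (y $ 1)) (cnj (y $ 3)) (cnj (y $ 2)) \<noteq> 0"
      using y(1) by (auto simp: hvec_eq_0_iff vec4_eq_iff)
    moreover have "hvec (y $ 0) (y $ 1) (y $ 2) (y $ 3) = y" by (simp add: vec4_eq_iff)
    ultimately show ?thesis using y by (simp add: real_str_pt)
  qed
  have real: "real_set ?C"
    unfolding real_set_def using conj invol by (metis image_eqI image_subsetI subsetI subset_antisym)
  have "2 \<le> local_int ?F ?G p" if p: "plane_incl l p \<in> ?C \<inter> surfaceB a b q0 q1 q2" for p
  proof -
    obtain y where y: "y \<noteq> 0" "p = pt y" by (rule cproj_rep)
    have F0: "eval3 ?F y = 0" and G0: "eval3 ?G y = 0"
      using p plane_incl_in_conic[OF C y(1)] plane_incl_in_surfaceB[OF y(1)] y(2) by blast+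
    \<comment> \<open>On \<open>y1 = 0\<close> the section gives \<open>y2 y3 = 0\<close>, and the
      conic then kills the remaining coordinate; all common points are affine.\<close>
    have y1: "y $ 1 \<noteq> 0"
    proof
      assume "y $ 1 = 0"
      with F0 G0 u0 r(2) have "y $ 2 = 0 \<and> y $ 3 = 0" by (auto simp: eval3_sectionB' eval3_unit_conic)
      then show False using y(1) \<open>y $ 1 = 0\<close> by (simp add: vec3_eq_iff)
    qed
    define t where "t = y $ 2 / y $ 1"
    define w where "w = y $ 3 / y $ 1"
    let ?v = "vector [1, t, w] :: complex ^ 3"
    have v: "?v \<noteq> 0" by (simp add: vec3_eq_iff)
    have y': "y = y $ 1 *s ?v" using y1 by (simp add: vec3_eq_iff t_def w_def)
    then have p': "p = pt ?v" using pt_eq_iff[OF v y(1)] y1 y(2) by metis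
    have F1: "eval3 ?F ?v = 0" and G1: "eval3 ?G ?v = 0"
      using p p' plane_incl_in_conic[OF C v] plane_incl_in_surfaceB[OF v] by blast+
    define q :: complex where "q = of_real Q"
    define \<rho> :: complex where "\<rho> = of_real r"
    have f: "of_real (cubic a b l) = \<rho>\<^sup>2" by (simp add: \<rho>_def r(1)[symmetric])
    have \<rho>0: "\<rho> \<noteq> 0" using r by (simp add: \<rho>_def)
    have qr: "q\<^sup>2 \<noteq> \<rho>\<^sup>2" using r(3)
      by (metis less_irrefl of_real_eq_iff of_real_power q_def \<rho>_def)
    have F2: "2 * (q\<^sup>2 - \<rho>\<^sup>2) + \<rho> * u * t\<^sup>2 + 2 * q * (t * w) + \<rho> * cnj u * w\<^sup>2 = 0"
      using F1 by (simp add: eval3_unit_conic q_def \<rho>_def)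
    have "(t * w + q)\<^sup>2 - \<rho>\<^sup>2 = 0"
      using G1 by (simp add: eval3_sectionB' Q[symmetric] f q_def)
    then have G2: "(t * w + (q - \<rho>)) * (t * w + (q + \<rho>)) = 0" by algebra
    have tw0: "t * w \<noteq> 0"
    proof
      assume "t * w = 0"
      then have "(q - \<rho>) * (q + \<rho>) = 0" using G2 by algebra
      then show False using qr by algebra
    qed
    text \<open>Restricted to the branch \<open>t w = - (Q \<mp> r)\<close>, the equation of the conic becomes
      \<open>r (u t\<^sup>2 \<mp> t w)\<^sup>2 = 0\<close> after multiplication by \<open>u t\<^sup>2\<close>.\<close>
    have "\<rho> * (u * t\<^sup>2 + t * w)\<^sup>2 = 0 \<or> \<rho> * (u * t\<^sup>2 - t * w)\<^sup>2 = 0"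
    proof (cases "t * w + (q - \<rho>) = 0")
      case True
      then have "\<rho> * (u * t\<^sup>2 - t * w)\<^sup>2 = 0" using F2 u by algebra
      then show ?thesis ..
    next
      case False
      then have "t * w + (q + \<rho>) = 0" using G2 by simp
      then have "\<rho> * (u * t\<^sup>2 + t * w)\<^sup>2 = 0" using F2 u by algebra
      then show ?thesis ..
    qed
    then have "(u * t\<^sup>2 + t * w) * (u * t\<^sup>2 - t * w) = 0" using \<rho>0 by auto
    then have "t\<^sup>2 * (u * t\<^sup>2 - cnj u * w\<^sup>2) = 0" using u by algebra
    then have tang: "u * t\<^sup>2 = cnj u * w\<^sup>2" using tw0 by simp
    \<comment> \<open>The slope of the branch on which \<open>t w\<close> is constant.\<close>
    define w' where "w' = - w / t"
    have w': "t * w' + w = 0" using tw0 by (simp add: w'_def)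
    show ?thesis unfolding p'
    proof (rule local_int_ge_2[where w' = w'])
      fix \<epsilon>
      \<comment> \<open>By choice of \<open>w'\<close> the mixed term has no part linear in
        \<open>\<epsilon>\<close>; the other linear terms cancel by \<open>tang\<close>.\<close>
      have "t * (2 * (\<rho> * u * t + \<rho> * cnj u * w * w')) = 2 * \<rho> * (u * t\<^sup>2 + cnj u * w * (t * w'))"
        by (simp add: algebra_simps power2_eq_square)
      also have "t * w' = - w" using w' by (simp add: eq_neg_iff_add_eq_0)
      also have "2 * \<rho> * (u * t\<^sup>2 + cnj u * w * - w) = 0"
        using tang by (simp add: power2_eq_square)
      finally have "\<rho> * u * t + \<rho> * cnj u * w * w' = 0"
        using tw0 by (metis mult_eq_0_iff zero_neq_numeral)
      then have "2 * (q\<^sup>2 - \<rho>\<^sup>2) + \<rho> * u * (t + \<epsilon>)\<^sup>2 + 2 * q * ((t + \<epsilon>) * (w + \<epsilon> * w'))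
          + \<rho> * cnj u * (w + \<epsilon> * w')\<^sup>2 = \<epsilon>\<^sup>2 * (\<rho> * u + 2 * q * w' + \<rho> * cnj u * w'\<^sup>2)"
        using F2 w' by algebra
      then show "eval3 ?F (vector [1, t + \<epsilon>, w + \<epsilon> * w']) =
          \<epsilon>\<^sup>2 * (\<lambda>_. \<rho> * u + 2 * q * w' + \<rho> * cnj u * w'\<^sup>2) \<epsilon>"
        by (simp add: eval3_unit_conic q_def \<rho>_def)
      have "((t + \<epsilon>) * (w + \<epsilon> * w') + q)\<^sup>2 - \<rho>\<^sup>2 = \<epsilon>\<^sup>2 * (w' * (\<epsilon>\<^sup>2 * w' + 2 * (t * w + q)))"
        using G2 w' by algebra
      then show "eval3 ?G (vector [1, t + \<epsilon>, w + \<epsilon> * w']) =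
          \<epsilon>\<^sup>2 * (\<lambda>\<epsilon>. w' * (\<epsilon>\<^sup>2 * w' + 2 * (t * w + q))) \<epsilon>"
        by (simp add: eval3_sectionB' Q[symmetric] f q_def)
    qed (intro continuous_intros)+
  qed
  then show "real_touching_conic a b q0 q1 q2 l ?C"
    unfolding real_touching_conic_def using C real by blast
qed

text \<open>At a fixed point the equation becomes a real Hermitian expression in which the term with
  \<open>r\<close> is at most \<open>2 r |y2|^2\<close> in absolute value. Positivity needs
  \<open>Q > r\<close>, not merely \<open>Q^2 > r^2\<close>.\<close>

lemma unit_conic_no_real_point:
  assumes r: "r > 0" "Q > r" and u: "norm u = 1" and p: "p \<in> plane_incl l ` zeros (unit_conic Q r u)"
  shows "real_str p \<noteq> p"
proof
  assume fixed: "real_str p = p"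
  have Q2: "Q\<^sup>2 > r\<^sup>2" using r by (simp add: power_strict_mono)
  have C: "conic_equation l (plane_incl l ` zeros (unit_conic Q r u)) (unit_conic Q r u)"
    using unit_conic_equation r u Q2 by simp
  obtain y where y: "y \<noteq> 0" "p = plane_incl l (pt y)" using p by (metis cproj_rep imageE)
  have F0: "eval3 (unit_conic Q r u) y = 0" using p plane_incl_in_conic[OF C y(1)] y(2) by simp
  have n: "(vector [cnj (y $ 1), cnj (y $ 3), cnj (y $ 2)] :: complex ^ 3) \<noteq> 0"
    using y(1) by (auto simp: vec3_eq_iff)
  have "pt y = pt (vector [cnj (y $ 1), cnj (y $ 3), cnj (y $ 2)])"
    using fixed unfolding y(2) real_str_plane_incl[OF y(1)] by (metis plane_incl_eqD)
  then obtain c where "c \<noteq> 0" "vector [cnj (y $ 1), cnj (y $ 3), cnj (y $ 2)] = c *s y"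
    using pt_eq_iff[OF y(1) n] by auto
  then have c: "cnj (y $ 1) = c * y $ 1" "cnj (y $ 3) = c * y $ 2" "cnj (y $ 2) = c * y $ 3" "c \<noteq> 0"
    by (simp_all add: vec3_eq_iff)
  define z where "z = u * (y $ 2 * cnj (y $ 3))"
  \<comment> \<open>The factor \<open>c\<close> turns one coordinate of each product into a
    conjugate.\<close>
  have "c * eval3 (unit_conic Q r u) y =
    of_real (2 * (Q\<^sup>2 - r\<^sup>2)) * (y $ 1 * (c * y $ 1)) + of_real r * (u * (y $ 2 * (c * y $ 2)))
    + of_real (2 * Q) * (y $ 2 * (c * y $ 3)) + of_real r * (cnj u * (y $ 3 * (c * y $ 3)))"
    by (simp add: eval3_unit_conic algebra_simps power2_eq_square)
  also have "\<dots> = of_real (2 * (Q\<^sup>2 - r\<^sup>2)) * (y $ 1 * cnj (y $ 1)) + of_real r * (z + cnj z)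
    + of_real (2 * Q) * (y $ 2 * cnj (y $ 2))"
    unfolding c[symmetric] z_def by (simp add: algebra_simps)
  also have "\<dots> = of_real (2 * (Q\<^sup>2 - r\<^sup>2) * (norm (y $ 1))\<^sup>2 + r * (2 * Re z) + 2 * Q * (norm (y $ 2))\<^sup>2)"
    by (simp only: complex_norm_square complex_add_cnj of_real_add of_real_mult)
  finally have "complex_of_real (2 * (Q\<^sup>2 - r\<^sup>2) * (norm (y $ 1))\<^sup>2 + r * (2 * Re z) + 2 * Q * (norm (y $ 2))\<^sup>2) = 0"
    using F0 by simp
  then have sum0: "2 * (Q\<^sup>2 - r\<^sup>2) * (norm (y $ 1))\<^sup>2 + r * (2 * Re z) + 2 * Q * (norm (y $ 2))\<^sup>2 = 0"
    by (simp only: of_real_eq_0_iff)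
  have n23: "norm (y $ 3) = norm (y $ 2)"
  proof -
    have "norm (y $ 3) = norm c * norm (y $ 2)" "norm (y $ 2) = norm c * norm (y $ 3)"
      using c(2,3)[THEN arg_cong[of _ _ norm]] by (simp_all add: norm_mult)
    then have "norm c * (norm (y $ 2))\<^sup>2 = norm c * (norm (y $ 3))\<^sup>2" by algebra
    then show ?thesis using c(4) by simp
  qed
  have "- Re z \<le> norm z" using abs_Re_le_cmod[of z] by linarith
  also have "norm z = (norm (y $ 2))\<^sup>2" by (simp add: z_def norm_mult u n23 power2_eq_square)
  finally have "r * (- Re z) \<le> r * (norm (y $ 2))\<^sup>2" using r by (intro mult_left_mono) auto
  then have "2 * (Q\<^sup>2 - r\<^sup>2) * (norm (y $ 1))\<^sup>2 + 2 * (Q - r) * (norm (y $ 2))\<^sup>2 \<le> 0"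
    using sum0 by (simp add: algebra_simps)
  moreover have "0 \<le> 2 * (Q\<^sup>2 - r\<^sup>2) * (norm (y $ 1))\<^sup>2" "0 \<le> 2 * (Q - r) * (norm (y $ 2))\<^sup>2"
    using r Q2 by simp_all
  ultimately have "2 * (Q\<^sup>2 - r\<^sup>2) * (norm (y $ 1))\<^sup>2 = 0" "2 * (Q - r) * (norm (y $ 2))\<^sup>2 = 0"
    by linarith+
  then have "y $ 1 = 0" "y $ 2 = 0" using r Q2 by auto
  then show False using n23 y(1) by (simp add: vec3_eq_iff)
qed

lemma zeros_conic_scale:
  "k \<noteq> 0 \<Longrightarrow> zeros (conic (k * a) (k * b) (k * c) (k * d) (k * e) (k * g)) = zeros (conic a b c d e g)"
proof -
  assume "k \<noteq> 0"
  moreover have "eval3 (conic (k * a) (k * b) (k * c) (k * d) (k * e) (k * g)) y = k * eval3 (conic a b c d e g) y" for y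
    by (simp add: eval3_conic algebra_simps)
  ultimately show ?thesis by (simp add: zeros_def)
qed

text \<open>If \<open>f\<close> vanished at \<open>l0\<close>, then so would \<open>Q\<close>, and
  \<open>(x - l0)^2\<close> would divide \<open>Q^2\<close> and hence \<open>f\<close>. For positive
  \<open>a\<close> and \<open>b\<close> the roots \<open>0\<close>, \<open>-1\<close>,
  \<open>b / a\<close> of \<open>f\<close> are simple.\<close>

lemma cubic_nonzero_at_touching:
  fixes a b q0 q1 q2 l0 :: real
  assumes "a > 0" "b > 0"
    and ord: "order l0 ((qform [:q0:] [:q1:] [:q2:] [:0, 1:] 1)\<^sup>2 - cubic [:a:] [:b:] [:0, 1:]) = 2"
    and Q0: "(qform q0 q1 q2 l0 1)\<^sup>2 = cubic a b l0"
  shows "cubic a b l0 \<noteq> 0"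
proof
  assume c0: "cubic a b l0 = 0"
  let ?q = "qform [:q0:] [:q1:] [:q2:] [:0, 1:] 1" and ?c = "cubic [:a:] [:b:] [:0, 1:]"
  have pq: "poly ?q l0 = qform q0 q1 q2 l0 1" by (simp add: qform_def poly_power)
  have "[:- l0, 1:] dvd ?q" using Q0 c0 pq by (simp add: poly_eq_0_iff_dvd[symmetric])
  then have "[:- l0, 1:] ^ 2 dvd ?q\<^sup>2" by (rule dvd_power_same)
  moreover have "[:- l0, 1:] ^ 2 dvd ?q\<^sup>2 - ?c" using order_1[of l0 "?q\<^sup>2 - ?c"] unfolding ord .
  ultimately have "[:- l0, 1:] ^ 2 dvd ?q\<^sup>2 - (?q\<^sup>2 - ?c)" by (rule dvd_diff)
  then have "[:- l0, 1:] ^ 2 dvd ?c" by simp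
  then obtain m where "?c = [:- l0, 1:] ^ 2 * m" by (auto simp: dvd_def)
  moreover have "poly (pderiv (L\<^sup>2 * m)) l0 = 0" if "poly L l0 = 0" for L
    by (simp add: pderiv_mult power2_eq_square that)
  ultimately have "poly (pderiv ?c) l0 = 0" by simp
  moreover have "?c = [:0, - b, a - b, a:]" by (simp add: cubic_def algebra_simps)
  \<comment> \<open>At the three roots this derivative is \<open>- b\<close>, \<open>a + b\<close>
    and \<open>a l0 + a l0^2\<close>, none of which is zero.\<close>
  ultimately have "- b + (a - b) * 2 * l0 + 3 * a * l0\<^sup>2 = 0"
    by (simp add: pderiv_pCons algebra_simps power2_eq_square)
  moreover have "l0 = 0 \<or> l0 = - 1 \<or> a * l0 = b" using c0 by (auto simp: cubic_def)
  ultimately show False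
  proof (elim disjE)
    assume "a * l0 = b"
    then have "l0 > 0" using assms(1,2) by (metis zero_less_mult_pos)
    moreover have "- b + (a - b) * 2 * l0 + 3 * a * l0\<^sup>2 = a * l0 + a * l0 * l0"
      unfolding \<open>a * l0 = b\<close>[symmetric] by (simp add: algebra_simps power2_eq_square)
    ultimately show ?thesis using assms(1) \<open>- b + (a - b) * 2 * l0 + 3 * a * l0\<^sup>2 = 0\<close>
      by (smt (verit) mult_pos_pos)
  qed (use assms(1,2) in auto)
qed

section \<open>Classification, non-existence and absence of real points\<close>

theorem proposition3p4:
  fixes a b q0 q1 q2 l0 l Q f :: real
  assumes "a > 0" and "b > 0"
    and "\<And>x. (qform q0 q1 q2 x 1)\<^sup>2 - cubic a b x \<ge> 0"
    and "\<And>x. (qform q0 q1 q2 x 1)\<^sup>2 - cubic a b x = 0 \<longleftrightarrow> x = l0"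
    and "order l0 ((qform [:q0:] [:q1:] [:q2:] [:0, 1:] 1)\<^sup>2 - cubic [:a:] [:b:] [:0, 1:]) = 2"
    and "\<And>x. cubic a b x \<ge> 0 \<Longrightarrow> x \<noteq> l0 \<Longrightarrow> qform q0 q1 q2 x 1 > sqrt (cubic a b x)"
    and "Q = qform q0 q1 q2 l 1" and "f = cubic a b l"
  shows
    "(f > 0 \<and> Q\<^sup>2 > f \<longrightarrow>
       (\<exists>C :: complex \<Rightarrow> 4 cproj set.
          (\<forall>\<theta>. conic_equation l (C (exp (\<i> * of_real \<theta>))) (family_form Q f \<theta>)) \<and>
          bij_betw C (sphere 0 1)
            {D. real_touching_conic a b q0 q1 q2 l D \<and> generic_type a b q0 q1 q2 l D})) \<and>
     (f < 0 \<or> Q\<^sup>2 = f \<longrightarrow>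
       \<not> (\<exists>D. real_touching_conic a b q0 q1 q2 l D \<and> generic_type a b q0 q1 q2 l D)) \<and>
     (Q\<^sup>2 > f \<and> f > 0 \<longrightarrow>
       (\<forall>\<theta>. \<not> (\<exists>p \<in> plane_incl l ` zeros (family_form Q f \<theta>). real_str p = p)))"
proof (intro conjI impI)
  have fam: "family_form Q f \<theta> = unit_conic Q (sqrt f) (exp (\<i> * of_real \<theta>))" if "f > 0" for \<theta>
    using that by (simp add: family_form_eq_conic unit_conic_def)
  have n1: "norm (exp (\<i> * of_real \<theta>)) = 1" for \<theta> by simp
  \<comment> \<open>\<open>Q^2 > f\<close> excludes \<open>l = l0\<close>, so the strict inequality
    assumed away from \<open>l0\<close> applies.\<close>
  have Qr: "Q > sqrt f" if "f > 0" "Q\<^sup>2 > f"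
    using assms(4)[of l] assms(6)[of l] assms(7,8) that by auto
  {
    assume fQ: "f > 0 \<and> Q\<^sup>2 > f"
    define r where "r = sqrt f"
    have r: "r > 0" "r\<^sup>2 = f" "Q > r" using fQ Qr by (auto simp: r_def)
    define C where "C = (\<lambda>u. plane_incl l ` zeros (unit_conic Q r u))"
    have "conic_equation l (C (exp (\<i> * of_real \<theta>))) (family_form Q f \<theta>)" for \<theta>
      unfolding C_def fam[OF conjunct1[OF fQ]] r_def[symmetric]
      using r fQ by (intro unit_conic_equation) auto
    moreover have "bij_betw C (sphere 0 1)
        {D. real_touching_conic a b q0 q1 q2 l D \<and> generic_type a b q0 q1 q2 l D}"
      unfolding bij_betw_def
    proof
      show "inj_on C (sphere 0 1)"
      proof (rule inj_onI)
        fix u v assume uv: "u \<in> sphere 0 1" "v \<in> sphere 0 1" "C u = C v"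
        then have "zeros (unit_conic Q r u) = zeros (unit_conic Q r v)"
          unfolding C_def using plane_incl_in_image by blast
        then show "u = v" using unit_conic_inj[of r Q u v] uv r fQ by simp
      qed
      show "C ` sphere 0 1 = {D. real_touching_conic a b q0 q1 q2 l D \<and> generic_type a b q0 q1 q2 l D}"
      proof (intro subset_antisym subsetI)
        fix D assume "D \<in> C ` sphere 0 1"
        then show "D \<in> {D. real_touching_conic a b q0 q1 q2 l D \<and> generic_type a b q0 q1 q2 l D}"
          using unit_conic_touching[OF assms(7), of r a b] r fQ assms(8) by (auto simp: C_def)
      next
        fix D assume "D \<in> {D. real_touching_conic a b q0 q1 q2 l D \<and> generic_type a b q0 q1 q2 l D}"
        then have D: "real_touching_conic a b q0 q1 q2 l D" "generic_type a b q0 q1 q2 l D" by auto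
        have "(complex_of_real r)\<^sup>2 = of_real (cubic a b l)" "complex_of_real r \<noteq> 0"
          using r assms(8) by (simp_all flip: of_real_power)
        from touching_generic_conic[OF D assms(7) this] obtain k s where ks: "k \<noteq> 0" "s \<noteq> 0"
          "cnj (of_real r) = of_real r * (s * cnj s)"
          "D = plane_incl l ` zeros (conic (k * (2 * ((of_real Q)\<^sup>2 - (of_real r)\<^sup>2))) 0 0
            (k * (of_real r / s)) (k * (2 * of_real Q)) (k * (of_real r * s)))"
          by metis
        from ks(3) have ss: "s * cnj s = 1" using r by simp
        then have "complex_of_real ((norm s)\<^sup>2) = 1" by (simp only: complex_norm_square)
        then have "(norm s)\<^sup>2 = 1" by (simp only: of_real_eq_1_iff)
        then have s1: "norm s = 1" by (metis abs_norm_cancel abs_square_eq_1)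
        have inv: "1 / s = cnj s" using ss ks(2) by (simp add: field_simps)
        \<comment> \<open>The coefficient \<open>r / s\<close> of \<open>y2^2\<close> equals
          \<open>r * cnj s\<close> on the unit circle, so the parameter is
          \<open>cnj s\<close>.\<close>
        have "D = C (cnj s)"
          unfolding C_def ks(4) unit_conic_def
          using zeros_conic_scale[OF ks(1), of "2 * ((of_real Q)\<^sup>2 - (of_real r)\<^sup>2)" 0 0
            "of_real r / s" "2 * of_real Q" "of_real r * s"] inv
          by (simp add: divide_inverse)
        then show "D \<in> C ` sphere 0 1" using s1 by simp
      qed
    qed
    ultimately show "\<exists>C :: complex \<Rightarrow> 4 cproj set.
          (\<forall>\<theta>. conic_equation l (C (exp (\<i> * of_real \<theta>))) (family_form Q f \<theta>)) \<and>
          bij_betw C (sphere 0 1)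
            {D. real_touching_conic a b q0 q1 q2 l D \<and> generic_type a b q0 q1 q2 l D}"
      by blast
  next
    assume f: "f < 0 \<or> Q\<^sup>2 = f"
    show "\<not> (\<exists>D. real_touching_conic a b q0 q1 q2 l D \<and> generic_type a b q0 q1 q2 l D)"
    proof
      assume "\<exists>D. real_touching_conic a b q0 q1 q2 l D \<and> generic_type a b q0 q1 q2 l D"
      then obtain D where D: "real_touching_conic a b q0 q1 q2 l D" "generic_type a b q0 q1 q2 l D" by auto
      have f0: "f \<noteq> 0"
      proof (cases "Q\<^sup>2 = f")
        case True
        then have "l = l0" using assms(4)[of l] assms(7,8) by simp
        then show ?thesis
          using cubic_nonzero_at_touching[OF assms(1,2,5)] True assms(7,8) by simp
      qed (use f in auto)
      \<comment> \<open>A complex root is taken because \<open>f\<close> may be negative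
        here.\<close>
      define r where "r = csqrt (of_real f)"
      have r: "r\<^sup>2 = of_real (cubic a b l)" "r \<noteq> 0" using f0 by (simp_all add: r_def assms(8))
      obtain s where s: "Q\<^sup>2 \<noteq> cubic a b l" "cnj r = r * (s * cnj s)"
        using touching_generic_conic[OF D assms(7) r] by metis
      \<comment> \<open>The conclusion \<open>Q^2 \<noteq> f\<close> already disposes of the case of
        equality. What remains is \<open>f < 0\<close>, where \<open>r\<close> is imaginary and
        \<open>cnj r = - r\<close> would give \<open>|s|^2 = -1\<close>.\<close>
      have f': "f < 0" using f s(1) assms(8) by auto
      have "r = \<i> * of_real (sqrt (- f))" using f' by (simp add: r_def csqrt_of_real_nonpos)
      then have "- r = r * (s * cnj s)" using s(2) by simp
      then have "r * (1 + s * cnj s) = 0" by algebra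
      then have "1 + s * cnj s = 0" using r(2) by simp
      then have "complex_of_real (1 + (norm s)\<^sup>2) = 0" by (simp only: of_real_add complex_norm_square of_real_1)
      then have "1 + (norm s)\<^sup>2 = 0" by (simp only: of_real_eq_0_iff)
      then show False by (smt (verit) zero_le_power2)
    qed
  next
    assume fQ: "Q\<^sup>2 > f \<and> f > 0"
    then have "sqrt f > 0" "Q > sqrt f" using Qr by auto
    then have "real_str p \<noteq> p" if "p \<in> plane_incl l ` zeros (family_form Q f \<theta>)" for p \<theta>
      using unit_conic_no_real_point[OF _ _ n1] that unfolding fam[OF conjunct2[OF fQ]] by blast
    then show "\<forall>\<theta>. \<not> (\<exists>p \<in> plane_incl l ` zeros (family_form Q f \<theta>). real_str p = p)"
      by blast
  }
qed

end
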